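(* (i) Let $\{H_n\}_{n\ge0}$ be the family of classical Hermite polynomials given by the Rodrigues formula $H_n(x)=(-1)^ne^{x^2}\frac{d^n}{dx^n}e^{-x^2}$, $x\in\mathbb{R}$. Then the functions $H_n^*(x)=e^{-x^2}H_n(x)$ are orthogonal with respect to the inverse Gaussian measure $d\gamma_{-1}(x)=\pi^{1/2}e^{x^2}dx$ on $\mathbb{R}$. Moreover, with $\widetilde{\mathcal O}=\frac{d^2}{dx^2}+2x\frac{d}{dx}$, one has $\widetilde{\mathcal O}H_n^*=-(2n+2)H_n^*$, and the family $\{H_n^*\}_{n\ge0}$ is an orthogonal basis of $L^2(\gamma_{-1})=L^2(\mathbb{R},\gamma_{-1})$. (ii) Fix $\alpha>-1$. Let $\{L_n^\alpha\}_{n\ge0}$ be the family of classical Laguerre polynomials given by the Rodrigues formula $L_n^\alpha(x)=\frac{e^{x}x^{-\alpha}}{n!}\frac{d^n}{dx^n}(e^{-x}x^{n+\alpha})$, $x\in(0,\infty)$. Then the functions $L_n^{\alpha,*}(x)=e^{-x}x^{\alpha}L_n^\alpha(x)$ are orthogonal with respect to the inverse Laguerre measure $e^{x}x^{-\alpha}dx$ on $(0,\infty)$. Moreover, with $\widetilde{\mathcal L}_\alpha=x\frac{d^2}{dx^2}+(-\alpha+1+x)\frac{d}{dx}$, one has $\widetilde{\mathcal L}_\alpha L_n^{\alpha,*}=-\big(n+\tfrac12\big)L_n^{\alpha,*}$, and the family $\{L_n^{\alpha,*}\}_{n\ge0}$ is an orthogonal basis of $L^2((0,\infty),e^{x}x^{-\alpha}dx)$.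 (iii) Fix $\alpha>-1$, $\beta>-1$. Let $\{P_n^{(\alpha,\beta)}\}_{n\ge0}$ be the family of classical Jacobi polynomials given by the Rodrigues formula $$P_n^{(\alpha,\beta)}(x)=\frac{(-1)^{n}}{2^nn!}(1-x)^{-\alpha}(1+x)^{-\beta}\frac{d^n}{dx^n}\big((1-x)^{\alpha+n}(1+x)^{\beta+n}\big),\qquad x\in(-1,1).$$ Then the functions $P_n^{(\alpha,\beta),*}(x)=(1-x)^{\alpha}(1+x)^{\beta}P_n^{(\alpha,\beta)}(x)$ are orthogonal with respect to the measure $(1-x)^{-\alpha}(1+x)^{-\beta}dx$ on $(-1,1)$. Moreover, with $\widetilde{\mathcal G}_{\alpha,\beta}=(1-x^2)\frac{d^2}{dx^2}+\big((\alpha-\beta)+(\alpha+\beta-2)x\big)\frac{d}{dx}$, one has $$\widetilde{\mathcal G}_{\alpha,\beta}P_n^{(\alpha,\beta),*}=\big(-n(n+\alpha+\beta+1)-2\big)P_n^{(\alpha,\beta),*},$$ and the family $\{P_n^{(\alpha,\beta),*}\}_{n\ge0}$ is an orthogonal basis of $L^2((-1,1),(1-x)^{-\alpha}(1+x)^{-\beta}dx)$.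
   Context: An orthogonal basis of a Hilbert space is a family of nonzero, pairwise orthogonal vectors whose linear span is dense.
   Formalization: Two eigenvalues are corrected: in (ii) −(n+1/2) becomes −(n+1) (the printed value fails, e.g. n=0, α=0, function e^{-x}); in (iii) −n(n+α+β+1)−2 becomes −n(n+α+β+1)−(α+β) (the printed value fails unless α+β=2, e.g. n=α=β=0, function 1). *)

theory Defs
  imports "HOL-Analysis.Analysis"
begin

text \<open>
  The real Hilbert space \<open>L\<^sup>2(M)\<close> is represented by square-integrable functions together with the
  semi-inner product \<open>l2_inner\<close>; two functions denote the same vector iff they agree almost
  everywhere, so a function denotes a nonzero vector iff it is not almost everywhere zero.
\<close>

definition l2_space :: "'a measure \<Rightarrow> ('a \<Rightarrow> real) set" where
  "l2_space M = {f \<in> borel_measurable M. integrable M (\<lambda>x. (f x)\<^sup>2)}"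

definition l2_inner :: "'a measure \<Rightarrow> ('a \<Rightarrow> real) \<Rightarrow> ('a \<Rightarrow> real) \<Rightarrow> real" where
  "l2_inner M f g = (\<integral>x. f x * g x \<partial>M)"

definition l2_norm :: "'a measure \<Rightarrow> ('a \<Rightarrow> real) \<Rightarrow> real" where
  "l2_norm M f = sqrt (l2_inner M f f)"

text \<open>
  Membership in \<open>l2_space\<close> is part of orthogonality, since the Bochner integral of a
  non-integrable function is \<open>0\<close>.
\<close>

definition l2_orthogonal :: "'a measure \<Rightarrow> ('i \<Rightarrow> 'a \<Rightarrow> real) \<Rightarrow> bool" where
  "l2_orthogonal M e \<longleftrightarrow>
     (\<forall>i. e i \<in> l2_space M) \<and> (\<forall>i j. i \<noteq> j \<longrightarrow> l2_inner M (e i) (e j) = 0)"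

definition l2_orthogonal_basis :: "'a measure \<Rightarrow> ('i \<Rightarrow> 'a \<Rightarrow> real) \<Rightarrow> bool" where
  "l2_orthogonal_basis M e \<longleftrightarrow>
     l2_orthogonal M e \<and>
     (\<forall>i. \<not> (AE x in M. e i x = 0)) \<and>
     (\<forall>f \<in> l2_space M. \<forall>\<epsilon>>0. \<exists>I c. finite I \<and>
        l2_norm M (\<lambda>x. f x - (\<Sum>i\<in>I. c i * e i x)) < \<epsilon>)"


definition hermite :: "nat \<Rightarrow> real \<Rightarrow> real" where
  "hermite n x = (-1) ^ n * exp (x\<^sup>2) * (deriv ^^ n) (\<lambda>y. exp (- y\<^sup>2)) x"

definition hermite_star :: "nat \<Rightarrow> real \<Rightarrow> real" where
  "hermite_star n x = exp (- x\<^sup>2) * hermite n x"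

definition inverse_gaussian_measure :: "real measure" where
  "inverse_gaussian_measure = density lborel (\<lambda>x. ennreal (sqrt pi * exp (x\<^sup>2)))"

definition hermite_op :: "(real \<Rightarrow> real) \<Rightarrow> real \<Rightarrow> real" where
  "hermite_op f x = deriv (deriv f) x + 2 * x * deriv f x"


text \<open>
  The Laguerre and Jacobi functions below are meaningful on \<open>(0,\<infinity>)\<close> and \<open>(-1,1)\<close> only; the
  arguments of \<open>powr\<close> are positive there, and these intervals are open, so values outside them
  affect neither the derivatives inside nor the integrals.
\<close>

definition laguerre :: "real \<Rightarrow> nat \<Rightarrow> real \<Rightarrow> real" where
  "laguerre \<alpha> n x =
     exp x * x powr (- \<alpha>) / fact n * (deriv ^^ n) (\<lambda>y. exp (- y) * y powr (real n + \<alpha>)) x"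

definition laguerre_star :: "real \<Rightarrow> nat \<Rightarrow> real \<Rightarrow> real" where
  "laguerre_star \<alpha> n x = exp (- x) * x powr \<alpha> * laguerre \<alpha> n x"

definition inverse_laguerre_measure :: "real \<Rightarrow> real measure" where
  "inverse_laguerre_measure \<alpha> =
     density (restrict_space lborel {0<..}) (\<lambda>x. ennreal (exp x * x powr (- \<alpha>)))"

text \<open>
  Pitfall: the eigenvalue of \<open>laguerre_op \<alpha>\<close> on \<open>laguerre_star \<alpha> n\<close> is \<open>-(n + 1)\<close>; the value
  \<open>-(n + 1/2)\<close> found in print is a misprint, as \<open>n = 0\<close>, \<open>\<alpha> = 0\<close> shows:
  \<open>laguerre_star 0 0 x = exp (- x)\<close>, and the operator maps it to
  \<open>x * exp (- x) - (1 + x) * exp (- x) = - exp (- x)\<close>.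
\<close>

definition laguerre_op :: "real \<Rightarrow> (real \<Rightarrow> real) \<Rightarrow> real \<Rightarrow> real" where
  "laguerre_op \<alpha> f x = x * deriv (deriv f) x + (- \<alpha> + 1 + x) * deriv f x"


definition jacobi :: "real \<Rightarrow> real \<Rightarrow> nat \<Rightarrow> real \<Rightarrow> real" where
  "jacobi \<alpha> \<beta> n x =
     (-1) ^ n / (2 ^ n * fact n) * (1 - x) powr (- \<alpha>) * (1 + x) powr (- \<beta>) *
     (deriv ^^ n) (\<lambda>y. (1 - y) powr (\<alpha> + real n) * (1 + y) powr (\<beta> + real n)) x"

definition jacobi_star :: "real \<Rightarrow> real \<Rightarrow> nat \<Rightarrow> real \<Rightarrow> real" where
  "jacobi_star \<alpha> \<beta> n x = (1 - x) powr \<alpha> * (1 + x) powr \<beta> * jacobi \<alpha> \<beta> n x"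

definition inverse_jacobi_measure :: "real \<Rightarrow> real \<Rightarrow> real measure" where
  "inverse_jacobi_measure \<alpha> \<beta> =
     density (restrict_space lborel {-1<..<1})
       (\<lambda>x. ennreal ((1 - x) powr (- \<alpha>) * (1 + x) powr (- \<beta>)))"

text \<open>
  Pitfall: the eigenvalue of \<open>jacobi_op \<alpha> \<beta>\<close> on \<open>jacobi_star \<alpha> \<beta> n\<close> is
  \<open>- n * (n + \<alpha> + \<beta> + 1) - (\<alpha> + \<beta>)\<close>; the value \<open>- n * (n + \<alpha> + \<beta> + 1) - 2\<close> found in print
  agrees with it only if \<open>\<alpha> + \<beta> = 2\<close>. For \<open>n = 0\<close>, \<open>\<alpha> = \<beta> = 0\<close> the function is the constant
  \<open>1\<close> on \<open>(-1,1)\<close>, which the operator maps to \<open>0\<close>, not \<open>-2\<close>.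
\<close>

definition jacobi_op :: "real \<Rightarrow> real \<Rightarrow> (real \<Rightarrow> real) \<Rightarrow> real \<Rightarrow> real" where
  "jacobi_op \<alpha> \<beta> f x =
     (1 - x\<^sup>2) * deriv (deriv f) x + ((\<alpha> - \<beta>) + (\<alpha> + \<beta> - 2) * x) * deriv f x"

end

theory Submission
  imports Defs "HOL-Probability.Distributions" "HOL-Real_Asymp.Real_Asymp"
begin

text \<open>
  All three families are treated at once. In each case there are an open interval \<open>I\<close>, a weight
  \<open>w > 0\<close> on \<open>I\<close>, and polynomials \<open>\<sigma>\<close> of degree at most 2 and \<open>\<tau>\<close> of degree 1 satisfying Pearson's
  equation \<open>(\<sigma> w)' = \<tau> w\<close>. The functions in question are multiples of the derivatives
  \<open>(\<sigma>\<^sup>n w)\<^sup>(\<^sup>n\<^sup>)\<close>, and the measure is a multiple of \<open>dx / w\<close>.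
  
  Pearson's equation makes the \<open>k\<close>-th derivative of \<open>\<sigma>\<^sup>n w\<close> equal to \<open>\<sigma>\<^sup>n\<^sup>-\<^sup>k w R\<^sub>k\<close> with polynomials \<open>R\<^sub>k\<close>
  defined by a first-order recursion. The decisive fact is \<open>pderiv_rodrigues_poly\<close>: \<open>R\<^sub>k\<^sub>+\<^sub>1'\<close> is a
  constant multiple of \<open>R\<^sub>k\<close>. Read at \<open>k < n\<close> it shows that \<open>R\<^sub>k\<close> has degree exactly \<open>k\<close>; read at
  \<open>k = n\<close> it is the differential equation, both for \<open>p\<^sub>n = R\<^sub>n\<close> and for \<open>w p\<^sub>n\<close>
  (\<open>orth_poly_differential_equation\<close>, \<open>dual_differential_equation\<close>).
  
  Orthogonality is the Sturm-Liouville argument: the differential equation for \<open>p\<^sub>n\<close> and \<open>p\<^sub>m\<close> shows that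
  \<open>\<sigma> w (p\<^sub>m p\<^sub>n' - p\<^sub>n p\<^sub>m')\<close> is a primitive of a multiple of \<open>w p\<^sub>n p\<^sub>m\<close>, where the factor is the
  difference of the eigenvalues; this primitive vanishes at both ends of \<open>I\<close>, and the eigenvalues
  are distinct (\<open>orth_poly_orthogonal\<close>).
  
  Dividing by \<open>w\<close> maps \<open>L\<^sup>2(dx / w)\<close> isometrically onto \<open>L\<^sup>2(w dx)\<close> and \<open>w p\<^sub>n\<close> to \<open>p\<^sub>n\<close>, so the family is
  total iff polynomials are dense in \<open>L\<^sup>2(w dx)\<close>. They are dense in \<open>L\<^sup>2(M)\<close> for every measure \<open>M\<close>
  on the line with \<open>\<integral>exp (\<delta> \<bar>x\<bar>) dM < \<infinity>\<close> for some \<open>\<delta> > 0\<close> (\<open>polynomials_dense\<close>). This is proved without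
  Fourier analysis or duality: let \<open>B\<close> be the algebra of bounded functions whose product with
  anything in the closure \<open>V\<close> of the polynomials stays in \<open>V\<close>. It contains \<open>sin (t x)\<close> for small \<open>t\<close>,
  because the Taylor series converges in \<open>L\<^sup>2\<close>, and it is closed under bounded pointwise limits. So
  the sets with indicator in \<open>B\<close> form a \<open>\<sigma>\<close>-algebra for which \<open>sin (t x) / t\<close> is measurable; letting
  \<open>t \<rightarrow> 0\<close>, so is \<open>x\<close>, and hence every Borel set is among them.
\<close>

section \<open>Square-integrable functions\<close>

lemma l2_space_dominated:
  assumes "f \<in> borel_measurable M" "g \<in> l2_space M" "\<And>x. x \<in> space M \<Longrightarrow> \<bar>f x\<bar> \<le> \<bar>g x\<bar>"
  shows "f \<in> l2_space M"
proof -
  have "integrable M (\<lambda>x. (f x)\<^sup>2)"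
  proof (rule Bochner_Integration.integrable_bound)
    show "integrable M (\<lambda>x. (g x)\<^sup>2)"
      using assms(2) by (simp add: l2_space_def)
    show "(\<lambda>x. (f x)\<^sup>2) \<in> borel_measurable M"
      using assms(1) by measurable
    show "AE x in M. norm ((f x)\<^sup>2) \<le> norm ((g x)\<^sup>2)"
      using assms(3) by (intro AE_I2) (simp add: abs_le_square_iff)
  qed
  with assms(1) show ?thesis
    by (simp add: l2_space_def)
qed

lemma power2_add_le: "(x + y)\<^sup>2 \<le> 2 * x\<^sup>2 + 2 * y\<^sup>2" for x y :: real
  using zero_le_power2[of "x - y"] by (simp add: power2_eq_square algebra_simps)

lemma l2_space_add:
  assumes "f \<in> l2_space M" "g \<in> l2_space M"
  shows "(\<lambda>x. f x + g x) \<in> l2_space M"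
    and "(\<integral>x. (f x + g x)\<^sup>2 \<partial>M) \<le> 2 * (\<integral>x. (f x)\<^sup>2 \<partial>M) + 2 * (\<integral>x. (g x)\<^sup>2 \<partial>M)"
proof -
  have [measurable]: "f \<in> borel_measurable M" "g \<in> borel_measurable M"
    and int: "integrable M (\<lambda>x. 2 * (f x)\<^sup>2 + 2 * (g x)\<^sup>2)"
    using assms by (auto simp: l2_space_def)
  have *: "integrable M (\<lambda>x. (f x + g x)\<^sup>2)"
    by (rule Bochner_Integration.integrable_bound[OF int]) (auto intro: power2_add_le)
  then show "(\<lambda>x. f x + g x) \<in> l2_space M"
    by (simp add: l2_space_def)
  have "(\<integral>x. (f x + g x)\<^sup>2 \<partial>M) \<le> (\<integral>x. 2 * (f x)\<^sup>2 + 2 * (g x)\<^sup>2 \<partial>M)"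
    by (rule integral_mono[OF * int]) (rule power2_add_le)
  also have "\<dots> = 2 * (\<integral>x. (f x)\<^sup>2 \<partial>M) + 2 * (\<integral>x. (g x)\<^sup>2 \<partial>M)"
    using assms by (simp add: l2_space_def)
  finally show "(\<integral>x. (f x + g x)\<^sup>2 \<partial>M) \<le> 2 * (\<integral>x. (f x)\<^sup>2 \<partial>M) + 2 * (\<integral>x. (g x)\<^sup>2 \<partial>M)" .
qed

lemma l2_space_cmult: "f \<in> l2_space M \<Longrightarrow> (\<lambda>x. c * f x) \<in> l2_space M"
  by (auto simp: l2_space_def power_mult_distrib)

lemma l2_space_diff:
  assumes "f \<in> l2_space M" "g \<in> l2_space M"
  shows "(\<lambda>x. f x - g x) \<in> l2_space M"
  using l2_space_add(1)[OF assms(1) l2_space_cmult[OF assms(2), of "-1"]] by simp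

lemma l2_space_dominated_convergence:
  assumes "h \<in> l2_space M" "f \<in> borel_measurable M" "\<And>n. g n \<in> borel_measurable M"
    and bound: "\<And>n x. x \<in> space M \<Longrightarrow> \<bar>g n x\<bar> \<le> \<bar>h x\<bar>"
    and lim: "\<And>x. x \<in> space M \<Longrightarrow> (\<lambda>n. g n x) \<longlonglongrightarrow> f x"
  shows "f \<in> l2_space M" and "(\<lambda>n. \<integral>x. (f x - g n x)\<^sup>2 \<partial>M) \<longlonglongrightarrow> 0"
proof -
  note [measurable] = assms(2,3)
  have fh: "\<bar>f x\<bar> \<le> \<bar>h x\<bar>" if "x \<in> space M" for x
    by (rule LIMSEQ_le_const2[OF tendsto_rabs[OF lim[OF that]]]) (use bound[OF that] in auto)
  show "f \<in> l2_space M"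
    using assms(2,1) fh by (rule l2_space_dominated)
  have "(\<lambda>n. \<integral>x. (f x - g n x)\<^sup>2 \<partial>M) \<longlonglongrightarrow> (\<integral>x. 0 \<partial>M)"
  proof (rule integral_dominated_convergence)
    show "integrable M (\<lambda>x. 4 * (h x)\<^sup>2)"
      using assms(1) by (simp add: l2_space_def)
    show "AE x in M. (\<lambda>n. (f x - g n x)\<^sup>2) \<longlonglongrightarrow> 0"
    proof (rule AE_I2)
      fix x assume "x \<in> space M"
      from tendsto_power[OF tendsto_diff[OF tendsto_const[of "f x"] lim[OF this]], of 2]
      show "(\<lambda>n. (f x - g n x)\<^sup>2) \<longlonglongrightarrow> 0" by simp
    qed
    show "AE x in M. norm ((f x - g n x)\<^sup>2) \<le> 4 * (h x)\<^sup>2" for n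
    proof (rule AE_I2)
      fix x assume x: "x \<in> space M"
      have "\<bar>f x - g n x\<bar> \<le> 2 * \<bar>h x\<bar>"
        using fh[OF x] bound[OF x, of n] by linarith
      then have "\<bar>f x - g n x\<bar>\<^sup>2 \<le> (2 * \<bar>h x\<bar>)\<^sup>2"
        by (rule power_mono) simp
      then show "norm ((f x - g n x)\<^sup>2) \<le> 4 * (h x)\<^sup>2"
        by (simp add: power_mult_distrib)
    qed
  qed measurable
  then show "(\<lambda>n. \<integral>x. (f x - g n x)\<^sup>2 \<partial>M) \<longlonglongrightarrow> 0" by simp
qed

section \<open>Density of polynomials under an exponential moment\<close>

lemma abs_poly_le_exp:
  fixes p :: "real poly"
  assumes "\<delta> > 0"
  shows "\<exists>C\<ge>0. \<forall>x. \<bar>poly p x\<bar> \<le> C * exp (\<delta> * \<bar>x\<bar>)"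
  using assms
proof (induction p arbitrary: \<delta>)
  case 0
  then show ?case by (intro exI[of _ 0]) auto
next
  case (pCons a p)
  then obtain C where C: "C \<ge> 0" "\<And>x. \<bar>poly p x\<bar> \<le> C * exp (\<delta> / 2 * \<bar>x\<bar>)"
    using pCons.IH[of "\<delta> / 2"] by auto
  have "\<bar>poly (pCons a p) x\<bar> \<le> (\<bar>a\<bar> + 2 / \<delta> * C) * exp (\<delta> * \<bar>x\<bar>)" for x
  proof -
    have "\<delta> / 2 * \<bar>x\<bar> \<le> exp (\<delta> / 2 * \<bar>x\<bar>)"
      using exp_ge_add_one_self[of "\<delta> / 2 * \<bar>x\<bar>"] by linarith
    then have x: "\<bar>x\<bar> \<le> 2 / \<delta> * exp (\<delta> / 2 * \<bar>x\<bar>)"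
      using \<open>\<delta> > 0\<close> by (simp add: field_simps)
    have "\<bar>x * poly p x\<bar> \<le> (2 / \<delta> * exp (\<delta> / 2 * \<bar>x\<bar>)) * (C * exp (\<delta> / 2 * \<bar>x\<bar>))"
      unfolding abs_mult using x C \<open>\<delta> > 0\<close> by (intro mult_mono) auto
    also have "\<dots> = 2 / \<delta> * C * exp (\<delta> * \<bar>x\<bar>)"
      using exp_add[of "\<delta> / 2 * \<bar>x\<bar>" "\<delta> / 2 * \<bar>x\<bar>"] by simp
    finally have "\<bar>x * poly p x\<bar> \<le> 2 / \<delta> * C * exp (\<delta> * \<bar>x\<bar>)" .
    moreover have "\<bar>a\<bar> \<le> \<bar>a\<bar> * exp (\<delta> * \<bar>x\<bar>)"
      using \<open>\<delta> > 0\<close> by (simp add: mult_le_cancel_left1)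
    ultimately show ?thesis
      using abs_triangle_ineq[of a "x * poly p x"] by (simp add: algebra_simps)
  qed
  moreover have "\<bar>a\<bar> + 2 / \<delta> * C \<ge> 0"
    using C \<open>\<delta> > 0\<close> by simp
  ultimately show ?case by blast
qed

lemma abs_sin_partial_sum_le: "\<bar>\<Sum>k<n. sin_coeff k * x ^ k\<bar> \<le> exp \<bar>x\<bar>"
proof -
  have "\<bar>\<Sum>k<n. sin_coeff k * x ^ k\<bar> \<le> (\<Sum>k<n. inverse (fact k) * \<bar>x\<bar> ^ k)"
  proof (rule order_trans[OF sum_abs sum_mono])
    fix k
    have "\<bar>sin_coeff k\<bar> \<le> inverse (fact k :: real)"
      by (simp add: sin_coeff_def power_abs field_simps)
    then show "\<bar>sin_coeff k * x ^ k\<bar> \<le> inverse (fact k) * \<bar>x\<bar> ^ k"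
      by (simp add: abs_mult power_abs mult_right_mono)
  qed
  also have "\<dots> \<le> exp \<bar>x\<bar>"
    unfolding exp_def using summable_exp_generic[of "\<bar>x\<bar>"]
    by (intro sum_le_suminf order_trans[OF sum_le_suminf]) (auto simp: divide_inverse mult.commute)
  finally show ?thesis .
qed

text \<open>
  The condition on the measurable sets covers both Borel measures on the whole line and
  measures living on the subspace of a Borel set, such as the restrictions to an interval.
\<close>

locale exp_moment_measure =
  fixes M :: "real measure" and \<delta> :: real
  assumes sets_M: "sets M = sets (restrict_space borel (space M))"
    and \<delta>_pos: "0 < \<delta>"
    and integrable_exp: "integrable M (\<lambda>x. exp (\<delta> * \<bar>x\<bar>))"
begin

lemma measurable_ident_M [measurable]: "(\<lambda>x. x) \<in> borel_measurable M"
  using measurable_restrict_space1[OF measurable_ident_sets[OF refl, of borel], of "space M"]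
  by (simp add: measurable_cong_sets[OF sets_M refl])

lemma measurable_poly_M [measurable]: "poly p \<in> borel_measurable M"
  by (rule measurable_compose[OF measurable_ident_M borel_measurable_continuous_onI])
    (intro continuous_intros)

text \<open>
  The function \<open>exp (\<delta> \<bar>x\<bar> / 4) p(x)\<close> is the majorant for the partial Taylor sums of \<open>sin (t x) p(x)\<close>.
  Squaring doubles the exponent, and the other half of \<open>\<delta>\<close> is spent on the square of \<open>p\<close>.
\<close>

lemma exp_mult_poly_l2: "(\<lambda>x. exp (\<delta> / 4 * \<bar>x\<bar>) * poly p x) \<in> l2_space M"
proof -
  obtain C where C: "C \<ge> 0" "\<And>x. \<bar>poly p x\<bar> \<le> C * exp (\<delta> / 4 * \<bar>x\<bar>)"
    using abs_poly_le_exp[of "\<delta> / 4" p] \<delta>_pos by auto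
  have "(\<lambda>x. exp (\<delta> / 2 * \<bar>x\<bar>)) \<in> l2_space M"
    using integrable_exp by (simp add: l2_space_def power2_eq_square flip: exp_add)
  then have "(\<lambda>x. C * exp (\<delta> / 2 * \<bar>x\<bar>)) \<in> l2_space M"
    by (rule l2_space_cmult)
  then show ?thesis
  proof (rule l2_space_dominated[rotated])
    fix x
    have "\<bar>exp (\<delta> / 4 * \<bar>x\<bar>) * poly p x\<bar> \<le> exp (\<delta> / 4 * \<bar>x\<bar>) * (C * exp (\<delta> / 4 * \<bar>x\<bar>))"
      unfolding abs_mult using C by (intro mult_mono) auto
    also have "\<dots> = C * exp (\<delta> / 2 * \<bar>x\<bar>)"
      using exp_add[of "\<delta> / 4 * \<bar>x\<bar>" "\<delta> / 4 * \<bar>x\<bar>"] by simp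
    finally show "\<bar>exp (\<delta> / 4 * \<bar>x\<bar>) * poly p x\<bar> \<le> \<bar>C * exp (\<delta> / 2 * \<bar>x\<bar>)\<bar>"
      by simp
  qed measurable
qed

lemma poly_l2: "poly p \<in> l2_space M"
proof (rule l2_space_dominated[OF _ exp_mult_poly_l2[of p]])
  show "\<bar>poly p x\<bar> \<le> \<bar>exp (\<delta> / 4 * \<bar>x\<bar>) * poly p x\<bar>" for x
    using \<delta>_pos by (simp add: abs_mult mult_le_cancel_right1)
qed measurable

definition poly_closure :: "(real \<Rightarrow> real) set" where
  "poly_closure = {f \<in> l2_space M. \<forall>\<epsilon>>0. \<exists>p. (\<integral>x. (f x - poly p x)\<^sup>2 \<partial>M) < \<epsilon>}"

lemma poly_in_closure: "poly p \<in> poly_closure"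
  unfolding poly_closure_def using poly_l2 by (auto intro!: exI[of _ p])

lemma poly_closure_l2: "f \<in> poly_closure \<Longrightarrow> f \<in> l2_space M"
  by (simp add: poly_closure_def)

lemma poly_closure_closed:
  assumes "f \<in> l2_space M"
    and approx: "\<And>\<epsilon>. \<epsilon> > 0 \<Longrightarrow> \<exists>g\<in>poly_closure. (\<integral>x. (f x - g x)\<^sup>2 \<partial>M) < \<epsilon>"
  shows "f \<in> poly_closure"
  unfolding poly_closure_def
proof (intro CollectI conjI allI impI assms(1))
  fix \<epsilon> :: real assume "\<epsilon> > 0"
  then obtain g where g: "g \<in> poly_closure" "(\<integral>x. (f x - g x)\<^sup>2 \<partial>M) < \<epsilon> / 4"
    using approx[of "\<epsilon> / 4"] by auto
  then obtain p where p: "(\<integral>x. (g x - poly p x)\<^sup>2 \<partial>M) < \<epsilon> / 4"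
    using \<open>\<epsilon> > 0\<close> unfolding poly_closure_def by (auto dest: spec[of _ "\<epsilon> / 4"])
  have "(\<integral>x. ((f x - g x) + (g x - poly p x))\<^sup>2 \<partial>M)
      \<le> 2 * (\<integral>x. (f x - g x)\<^sup>2 \<partial>M) + 2 * (\<integral>x. (g x - poly p x)\<^sup>2 \<partial>M)"
    by (intro l2_space_add(2) l2_space_diff poly_l2 assms(1) poly_closure_l2[OF g(1)])
  also have "\<dots> < \<epsilon>"
    using g p by linarith
  finally show "\<exists>p. (\<integral>x. (f x - poly p x)\<^sup>2 \<partial>M) < \<epsilon>"
    by (auto simp: algebra_simps)
qed

lemma poly_closure_dominated_limit:
  assumes "h \<in> l2_space M" "f \<in> borel_measurable M" "\<And>n. g n \<in> poly_closure"
    and "\<And>n x. x \<in> space M \<Longrightarrow> \<bar>g n x\<bar> \<le> \<bar>h x\<bar>"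
    and "\<And>x. x \<in> space M \<Longrightarrow> (\<lambda>n. g n x) \<longlonglongrightarrow> f x"
  shows "f \<in> poly_closure"
proof -
  have g: "g n \<in> borel_measurable M" for n
    using assms(3)[THEN poly_closure_l2] by (simp add: l2_space_def)
  note lim = l2_space_dominated_convergence[OF assms(1,2) g assms(4,5)]
  show ?thesis
  proof (rule poly_closure_closed[OF lim(1)])
    fix \<epsilon> :: real assume "\<epsilon> > 0"
    with lim(2) have "\<forall>\<^sub>F n in sequentially. (\<integral>x. (f x - g n x)\<^sup>2 \<partial>M) < \<epsilon>"
      by (rule order_tendstoD)
    then show "\<exists>g\<in>poly_closure. (\<integral>x. (f x - g x)\<^sup>2 \<partial>M) < \<epsilon>"
      using assms(3) by (auto simp: eventually_sequentially)
  qed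
qed

lemma poly_closure_add:
  assumes "f \<in> poly_closure" "g \<in> poly_closure"
  shows "(\<lambda>x. f x + g x) \<in> poly_closure"
proof (rule poly_closure_closed)
  show "(\<lambda>x. f x + g x) \<in> l2_space M"
    using assms by (intro l2_space_add(1) poly_closure_l2)
  fix \<epsilon> :: real assume "\<epsilon> > 0"
  then have "\<epsilon> / 4 > 0" by simp
  with assms obtain p q where p: "(\<integral>x. (f x - poly p x)\<^sup>2 \<partial>M) < \<epsilon> / 4"
    and q: "(\<integral>x. (g x - poly q x)\<^sup>2 \<partial>M) < \<epsilon> / 4"
    unfolding poly_closure_def by blast
  have "(\<integral>x. ((f x - poly p x) + (g x - poly q x))\<^sup>2 \<partial>M)
      \<le> 2 * (\<integral>x. (f x - poly p x)\<^sup>2 \<partial>M) + 2 * (\<integral>x. (g x - poly q x)\<^sup>2 \<partial>M)"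
    by (intro l2_space_add(2) l2_space_diff poly_l2 poly_closure_l2 assms)
  also have "\<dots> < \<epsilon>"
    using p q by linarith
  finally have "(\<integral>x. (f x + g x - poly (p + q) x)\<^sup>2 \<partial>M) < \<epsilon>"
    by (simp add: algebra_simps)
  then show "\<exists>h\<in>poly_closure. (\<integral>x. (f x + g x - h x)\<^sup>2 \<partial>M) < \<epsilon>"
    using poly_in_closure by blast
qed

text \<open>
  Asking for stability of the whole closure, and not just for membership in it, makes the set of
  multipliers an algebra, which the closure of the polynomials is not in any evident way.
\<close>

definition multipliers :: "(real \<Rightarrow> real) set" where
  "multipliers = {g \<in> borel_measurable M. (\<exists>K. \<forall>x\<in>space M. \<bar>g x\<bar> \<le> K) \<and>
     (\<forall>f\<in>poly_closure. (\<lambda>x. g x * f x) \<in> poly_closure)}"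

text \<open>
  Multiplication by a bounded function is continuous in \<open>L\<^sup>2\<close>, so it preserves the closure as soon as it
  sends polynomials into it.
\<close>

lemma multiplierI:
  assumes g [measurable]: "g \<in> borel_measurable M" and K: "\<And>x. x \<in> space M \<Longrightarrow> \<bar>g x\<bar> \<le> K"
    and poly: "\<And>p. (\<lambda>x. g x * poly p x) \<in> poly_closure"
  shows "g \<in> multipliers"
proof -
  have l2: "(\<lambda>x. g x * f x) \<in> l2_space M"
    and bound: "(\<integral>x. (g x * f x)\<^sup>2 \<partial>M) \<le> K\<^sup>2 * (\<integral>x. (f x)\<^sup>2 \<partial>M)"
    if f: "f \<in> l2_space M" for f
  proof -
    have [measurable]: "f \<in> borel_measurable M"
      using f by (simp add: l2_space_def)
    have le: "(g x * f x)\<^sup>2 \<le> K\<^sup>2 * (f x)\<^sup>2" if "x \<in> space M" for x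
      using power_mono[OF K[OF that], of 2] by (simp add: power_mult_distrib mult_right_mono)
    have f2: "integrable M (\<lambda>x. K\<^sup>2 * (f x)\<^sup>2)"
      using f by (simp add: l2_space_def)
    have gf2: "integrable M (\<lambda>x. (g x * f x)\<^sup>2)"
      by (rule Bochner_Integration.integrable_bound[OF f2]) (use le in auto)
    then show "(\<lambda>x. g x * f x) \<in> l2_space M"
      by (simp add: l2_space_def)
    have "(\<integral>x. (g x * f x)\<^sup>2 \<partial>M) \<le> (\<integral>x. K\<^sup>2 * (f x)\<^sup>2 \<partial>M)"
      by (rule integral_mono[OF gf2 f2 le])
    then show "(\<integral>x. (g x * f x)\<^sup>2 \<partial>M) \<le> K\<^sup>2 * (\<integral>x. (f x)\<^sup>2 \<partial>M)"
      by simp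
  qed
  have "(\<lambda>x. g x * f x) \<in> poly_closure" if f: "f \<in> poly_closure" for f
  proof (rule poly_closure_closed[OF l2[OF poly_closure_l2[OF f]]])
    fix \<epsilon> :: real assume "\<epsilon> > 0"
    have K1: "K\<^sup>2 + 1 > 0"
      by (simp add: add_nonneg_pos)
    then have "\<epsilon> / (K\<^sup>2 + 1) > 0"
      using \<open>\<epsilon> > 0\<close> by simp
    then obtain p where p: "(\<integral>x. (f x - poly p x)\<^sup>2 \<partial>M) < \<epsilon> / (K\<^sup>2 + 1)"
      using f unfolding poly_closure_def by blast
    have "(\<integral>x. (g x * (f x - poly p x))\<^sup>2 \<partial>M) \<le> K\<^sup>2 * (\<integral>x. (f x - poly p x)\<^sup>2 \<partial>M)"
      using f by (intro bound l2_space_diff poly_l2 poly_closure_l2)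
    also have "\<dots> \<le> (K\<^sup>2 + 1) * (\<integral>x. (f x - poly p x)\<^sup>2 \<partial>M)"
      by (intro mult_right_mono) auto
    also have "\<dots> < \<epsilon>"
      using p K1 by (simp add: field_simps)
    finally show "\<exists>h\<in>poly_closure. (\<integral>x. (g x * f x - h x)\<^sup>2 \<partial>M) < \<epsilon>"
      using poly by (auto simp: algebra_simps intro!: bexI[of _ "\<lambda>x. g x * poly p x"])
  qed
  with g K show ?thesis
    unfolding multipliers_def by blast
qed

lemma multipliers_const: "(\<lambda>x. c) \<in> multipliers"
proof (rule multiplierI[where K = "\<bar>c\<bar>"])
  show "(\<lambda>x. c * poly p x) \<in> poly_closure" for p
    using poly_in_closure[of "smult c p"] by (simp add: poly_smult[abs_def])
qed auto

lemma multipliers_add: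
  assumes "f \<in> multipliers" "g \<in> multipliers"
  shows "(\<lambda>x. f x + g x) \<in> multipliers"
proof -
  obtain K L where "\<forall>x\<in>space M. \<bar>f x\<bar> \<le> K" "\<forall>x\<in>space M. \<bar>g x\<bar> \<le> L"
    using assms by (auto simp: multipliers_def)
  then have "\<forall>x\<in>space M. \<bar>f x + g x\<bar> \<le> K + L"
    by (auto intro: order_trans[OF abs_triangle_ineq] add_mono)
  then show ?thesis
    using assms by (auto simp: multipliers_def distrib_right intro: poly_closure_add)
qed

lemma multipliers_mult:
  assumes "f \<in> multipliers" "g \<in> multipliers"
  shows "(\<lambda>x. f x * g x) \<in> multipliers"
proof -
  obtain K L where "\<forall>x\<in>space M. \<bar>f x\<bar> \<le> K" "\<forall>x\<in>space M. \<bar>g x\<bar> \<le> L"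
    using assms by (auto simp: multipliers_def)
  then have "\<forall>x\<in>space M. \<bar>f x * g x\<bar> \<le> K * L"
    by (auto simp: abs_mult intro!: mult_mono order_trans[OF abs_ge_zero])
  then show ?thesis
    using assms by (auto simp: multipliers_def mult.assoc)
qed

lemma multipliers_poly:
  assumes "g \<in> multipliers"
  shows "(\<lambda>x. poly p (g x)) \<in> multipliers"
  by (induction p) (simp_all add: multipliers_const multipliers_add multipliers_mult assms)

lemma multipliers_sum:
  assumes "finite I" "\<And>i. i \<in> I \<Longrightarrow> g i \<in> multipliers"
  shows "(\<lambda>x. \<Sum>i\<in>I. g i x) \<in> multipliers"
  using assms by (induction I) (simp_all add: multipliers_const multipliers_add)

lemma multipliers_bounded_limit:
  assumes g: "\<And>n. g n \<in> multipliers" and K: "\<And>n x. x \<in> space M \<Longrightarrow> \<bar>g n x\<bar> \<le> K"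
    and lim: "\<And>x. x \<in> space M \<Longrightarrow> (\<lambda>n. g n x) \<longlonglongrightarrow> f x"
  shows "f \<in> multipliers"
proof (rule multiplierI)
  have [measurable]: "g n \<in> borel_measurable M" for n
    using g by (auto simp: multipliers_def)
  show [measurable]: "f \<in> borel_measurable M"
    using lim by (rule borel_measurable_LIMSEQ_real) measurable
  show "\<bar>f x\<bar> \<le> K" if "x \<in> space M" for x
    by (rule LIMSEQ_le_const2[OF tendsto_rabs[OF lim[OF that]]]) (use K[OF that] in auto)
  show "(\<lambda>x. f x * poly p x) \<in> poly_closure" for p
  proof (rule poly_closure_dominated_limit)
    show "(\<lambda>x. K * poly p x) \<in> l2_space M"
      by (intro l2_space_cmult poly_l2)
    show "(\<lambda>x. g n x * poly p x) \<in> poly_closure" for n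
      using g poly_in_closure by (auto simp: multipliers_def)
    show "\<bar>g n x * poly p x\<bar> \<le> \<bar>K * poly p x\<bar>" if "x \<in> space M" for n x
      unfolding abs_mult using K[OF that, of n] by (intro mult_right_mono) auto
    show "(\<lambda>n. g n x * poly p x) \<longlonglongrightarrow> f x * poly p x" if "x \<in> space M" for x
      by (intro tendsto_intros lim that)
  qed measurable
qed

lemma multipliers_cong:
  assumes "g \<in> multipliers" "\<And>x. x \<in> space M \<Longrightarrow> g x = f x"
  shows "f \<in> multipliers"
proof -
  obtain K where "\<forall>x\<in>space M. \<bar>g x\<bar> \<le> K"
    using assms by (auto simp: multipliers_def)
  then show ?thesis
    using assms multipliers_bounded_limit[of "\<lambda>n. g" K f] by auto
qed

text \<open>
  The Taylor sums are bounded by \<open>exp (\<bar>t\<bar> \<bar>x\<bar>)\<close>, so for these frequencies \<open>exp_mult_poly_l2\<close> provides a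
  square-integrable majorant. Small frequencies are all that is needed below, where \<open>t \<rightarrow> 0\<close>.
\<close>

lemma sin_multiplier:
  assumes "\<bar>t\<bar> \<le> \<delta> / 4"
  shows "(\<lambda>x. sin (t * x)) \<in> multipliers"
proof (rule multiplierI[where K = 1])
  show "(\<lambda>x. sin (t * x) * poly p x) \<in> poly_closure" for p
  proof (rule poly_closure_dominated_limit[OF exp_mult_poly_l2])
    let ?S = "\<lambda>n x. \<Sum>k<n. sin_coeff k * (t * x) ^ k"
    show "(\<lambda>x. ?S n x * poly p x) \<in> poly_closure" for n
    proof -
      have "(\<lambda>x. ?S n x * poly p x) = poly ((\<Sum>k<n. monom (sin_coeff k * t ^ k) k) * p)"
        by (auto simp: poly_sum poly_monom power_mult_distrib mult.assoc)
      then show ?thesis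
        using poly_in_closure by simp
    qed
    show "\<bar>?S n x * poly p x\<bar> \<le> \<bar>exp (\<delta> / 4 * \<bar>x\<bar>) * poly p x\<bar>" for n x
    proof -
      have "\<bar>?S n x\<bar> \<le> exp \<bar>t * x\<bar>"
        by (rule abs_sin_partial_sum_le)
      also have "\<dots> \<le> exp (\<delta> / 4 * \<bar>x\<bar>)"
        using assms by (simp only: exp_le_cancel_iff abs_mult mult_right_mono abs_ge_zero)
      finally show ?thesis
        by (simp add: abs_mult mult_right_mono)
    qed
    show "(\<lambda>n. ?S n x * poly p x) \<longlonglongrightarrow> sin (t * x) * poly p x" for x
      using sin_converges[of "t * x"] by (intro tendsto_intros) (simp add: sums_def)
  qed measurable
qed auto

text \<open>
  The indicator of \<open>{c < g}\<close> is the limit of \<open>\<phi>\<^sub>m \<circ> g\<close> for continuous ramps \<open>\<phi>\<^sub>m\<close>. Polynomials in \<open>g\<close> are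
  multipliers, and by Weierstrass they approximate \<open>\<phi>\<^sub>m \<circ> g\<close> within \<open>1 / (m + 1)\<close>.
\<close>

lemma multipliers_superlevel:
  assumes g: "g \<in> multipliers" and g1: "\<And>x. x \<in> space M \<Longrightarrow> \<bar>g x\<bar> \<le> 1"
  shows "indicator {x \<in> space M. c < g x} \<in> multipliers"
proof -
  define \<phi> where "\<phi> m y = min 1 (max 0 (real m * (y - c)))" for m y
  have "\<exists>q. \<forall>y\<in>{-1..1}. \<bar>\<phi> m y - poly q y\<bar> < 1 / real (Suc m)" for m
  proof -
    have "continuous_on {-1..1} (\<phi> m)"
      unfolding \<phi>_def by (intro continuous_intros)
    then obtain h where "real_polynomial_function h" "\<And>y. y \<in> {-1..1} \<Longrightarrow> \<bar>\<phi> m y - h y\<bar> < 1 / real (Suc m)"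
      using Stone_Weierstrass_real_polynomial_function[of "{-1..1}" "\<phi> m" "1 / real (Suc m)"] by auto
    moreover then obtain a n where "h = (\<lambda>x. \<Sum>i\<le>n. a i * x ^ i)"
      by (auto simp: real_polynomial_function_iff_sum)
    then have "h = poly (\<Sum>i\<le>n. monom (a i) i)"
      by (auto simp: poly_sum poly_monom)
    ultimately show ?thesis by blast
  qed
  then obtain q where q: "\<And>m y. y \<in> {-1..1} \<Longrightarrow> \<bar>\<phi> m y - poly (q m) y\<bar> < 1 / real (Suc m)"
    by metis
  have q': "\<bar>\<phi> m (g x) - poly (q m) (g x)\<bar> < 1 / real (Suc m)" if "x \<in> space M" for m x
    using q[of "g x" m] g1[OF that] by (simp add: abs_le_iff)
  \<comment> \<open>The bound 2 is the supremum 1 of the ramps plus the approximation error.\<close>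
  show ?thesis
  proof (rule multipliers_bounded_limit[where g = "\<lambda>m x. poly (q m) (g x)" and K = 2])
    show "(\<lambda>x. poly (q m) (g x)) \<in> multipliers" for m
      using g by (rule multipliers_poly)
    show "\<bar>poly (q m) (g x)\<bar> \<le> 2" if "x \<in> space M" for m x
    proof -
      have "0 \<le> \<phi> m (g x)" "\<phi> m (g x) \<le> 1" "1 / real (Suc m) \<le> 1"
        by (auto simp: \<phi>_def)
      then show ?thesis
        using q'[OF that, of m] by linarith
    qed
    show "(\<lambda>m. poly (q m) (g x)) \<longlonglongrightarrow> indicator {x \<in> space M. c < g x} x" if x: "x \<in> space M" for x
    proof -
      have "(\<lambda>m. \<phi> m (g x) - poly (q m) (g x)) \<longlonglongrightarrow> 0"
        using q'[OF x] by (intro LIMSEQ_norm_0) auto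
      moreover have "(\<lambda>m. \<phi> m (g x)) \<longlonglongrightarrow> indicator {x \<in> space M. c < g x} x"
      proof (rule tendsto_eventually)
        show "\<forall>\<^sub>F m in sequentially. \<phi> m (g x) = indicator {x \<in> space M. c < g x} x"
        proof (cases "c < g x")
          case True
          obtain m0 where m0: "1 / (g x - c) \<le> real m0"
            using real_arch_simple by blast
          have "\<phi> m (g x) = 1" if "m \<ge> m0" for m
          proof -
            have "1 / (g x - c) \<le> real m"
              using m0 that by linarith
            then have "1 \<le> real m * (g x - c)"
              using True by (simp add: field_simps)
            then show ?thesis by (simp add: \<phi>_def)
          qed
          then show ?thesis
            using True x by (auto simp: eventually_sequentially)
        next
          case False
          then have "\<phi> m (g x) = 0" for m
            by (simp add: \<phi>_def mult_nonneg_nonpos)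
          then show ?thesis
            using False by simp
        qed
      qed
      ultimately show ?thesis
        using tendsto_diff by fastforce
    qed
  qed
qed

text \<open>
  The sets whose indicators are multipliers form a \<open>\<sigma>\<close>-algebra. The coordinate function is
  measurable for it, as the limit of \<open>sin (t x) / t\<close> for \<open>t \<rightarrow> 0\<close>, so it contains all Borel sets.
\<close>

lemma indicator_multiplier:
  assumes "A \<in> sets M"
  shows "indicator A \<in> multipliers"
proof -
  define \<S> where "\<S> = {A \<in> sets M. indicator A \<in> multipliers}"
  have Int: "A \<inter> B \<in> \<S>" if "A \<in> \<S>" "B \<in> \<S>" for A B
  proof -
    have "indicator (A \<inter> B) = (\<lambda>x. indicator A x * indicator B x :: real)"
      by (auto simp: indicator_def)
    then show ?thesis
      using that multipliers_mult[of "indicator A" "indicator B"] by (auto simp: \<S>_def)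
  qed
  have compl: "space M - A \<in> \<S>" if A: "A \<in> \<S>" for A
  proof -
    have "(\<lambda>x. 1 + - 1 * indicator A x) \<in> multipliers"
      using A by (intro multipliers_add multipliers_mult multipliers_const) (auto simp: \<S>_def)
    then have "indicator (space M - A) \<in> multipliers"
      by (rule multipliers_cong) (auto simp: indicator_def)
    with A show ?thesis by (auto simp: \<S>_def)
  qed
  have empty: "{} \<in> \<S>"
    using multipliers_const[of 0] by (simp add: \<S>_def indicator_def[abs_def])
  have Un: "A \<union> B \<in> \<S>" if "A \<in> \<S>" "B \<in> \<S>" for A B
  proof -
    have "A \<subseteq> space M" "B \<subseteq> space M"
      using that by (auto simp: \<S>_def dest: sets.sets_into_space)
    then have "A \<union> B = space M - ((space M - A) \<inter> (space M - B))"
      by auto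
    then show ?thesis
      using compl Int that by simp
  qed
  have "algebra (space M) \<S>"
    unfolding algebra_iff_Un using empty compl Un by (auto simp: \<S>_def dest: sets.sets_into_space)
  then have sa: "sigma_algebra (space M) \<S>"
  proof (rule sigma_algebra.intro)
    show "sigma_algebra_axioms \<S>"
    proof
      fix A :: "nat \<Rightarrow> real set" assume A: "range A \<subseteq> \<S>"
      have fin: "(\<Union>i<n. A i) \<in> \<S>" for n
        using A by (induction n) (auto simp: lessThan_Suc empty intro!: Un)
      have "indicator (\<Union>i. A i) \<in> multipliers"
      proof (rule multipliers_bounded_limit[where g = "\<lambda>n. indicator (\<Union>i<n. A i)" and K = 1])
        show "(\<lambda>n. indicator (\<Union>i<n. A i) x) \<longlonglongrightarrow> indicator (\<Union>i. A i) x" for x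
          by (rule LIMSEQ_indicator_UN)
      qed (use fin in \<open>auto simp: \<S>_def\<close>)
      then show "(\<Union>i. A i) \<in> \<S>"
        using A by (auto simp: \<S>_def)
    qed
  qed
  define N where "N = measure_of (space M) \<S> (\<lambda>_. 0)"
  have space_N: "space N = space M" and sets_N: "sets N = \<S>"
    using sa by (auto simp: N_def \<S>_def dest: sets.sets_into_space
        intro!: space_measure_of sigma_algebra.sets_measure_of_eq)
  have sin_N: "(\<lambda>x. sin (t * x)) \<in> borel_measurable N" if "\<bar>t\<bar> \<le> \<delta> / 4" for t
    unfolding borel_measurable_iff_greater
    using multipliers_superlevel[OF sin_multiplier[OF that]]
    by (auto simp: space_N sets_N \<S>_def)
  have id_N: "(\<lambda>x. x) \<in> borel_measurable N"
  proof (rule borel_measurable_LIMSEQ_real)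
    define t where "t n = \<delta> / 4 / real (Suc n)" for n
    have t0: "t n > 0" for n
      using \<delta>_pos by (simp add: t_def)
    have tle: "\<bar>t n\<bar> \<le> \<delta> / 4" for n
      using \<delta>_pos by (simp add: t_def field_simps)
    show "(\<lambda>x. sin (t n * x) / t n) \<in> borel_measurable N" for n
      using sin_N[OF tle, of n] by (rule borel_measurable_divide) auto
    show "(\<lambda>n. sin (t n * x) / t n) \<longlonglongrightarrow> x" for x
    proof -
      have "((\<lambda>s. sin (s * x)) has_real_derivative x) (at 0)"
        by (auto intro!: derivative_eq_intros)
      then have "((\<lambda>s. sin (s * x) / s) \<longlongrightarrow> x) (at 0)"
        by (simp add: has_field_derivative_iff)
      moreover have "filterlim t (at 0) sequentially"
      proof -
        have "(\<lambda>n. \<delta> / 4 * inverse (real (Suc n))) \<longlonglongrightarrow> \<delta> / 4 * 0"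
          by (intro tendsto_mult tendsto_const LIMSEQ_inverse_real_of_nat)
        then have "t \<longlonglongrightarrow> 0"
          unfolding t_def divide_inverse[of "\<delta> / 4"] by simp
        then show ?thesis
          using t0 by (simp add: filterlim_at less_imp_neq[OF t0, THEN not_sym])
      qed
      ultimately show ?thesis
        by (rule filterlim_compose)
    qed
  qed
  obtain B where "B \<in> sets borel" "A = space M \<inter> B"
    using assms by (subst (asm) sets_M) (auto simp: sets_restrict_space)
  then have "A = (\<lambda>x. x) -` B \<inter> space N"
    by (auto simp: space_N)
  then have "A \<in> sets N"
    using measurable_sets[OF id_N \<open>B \<in> sets borel\<close>] by simp
  then show ?thesis
    by (simp add: sets_N \<S>_def)
qed

text \<open>
  Simple functions are multipliers, hence (applied to the constant polynomial 1) elements of the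
  closure, and they approximate any square-integrable function with a square-integrable majorant.
\<close>

theorem polynomials_dense:
  assumes f: "f \<in> l2_space M"
  shows "f \<in> poly_closure"
proof -
  have [measurable]: "f \<in> borel_measurable M"
    using f by (simp add: l2_space_def)
  then obtain s where "\<forall>i. simple_function M (s i)" "\<forall>x\<in>space M. (\<lambda>i. s i x) \<longlonglongrightarrow> f x"
    "\<forall>i. \<forall>x\<in>space M. dist (s i x) 0 \<le> 2 * dist (f x) 0"
    using borel_measurable_implies_sequence_metric[of f M 0] by blast
  then have s: "simple_function M (s i)"
    and lim: "x \<in> space M \<Longrightarrow> (\<lambda>i. s i x) \<longlonglongrightarrow> f x"
    and bound: "x \<in> space M \<Longrightarrow> \<bar>s i x\<bar> \<le> 2 * \<bar>f x\<bar>" for i x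
    by (simp_all add: dist_real_def)
  have simple: "s i \<in> multipliers" for i
  proof (rule multipliers_cong)
    let ?A = "\<lambda>y. s i -` {y} \<inter> space M"
    have fin: "finite (s i ` space M)" and A: "?A y \<in> sets M" for y
      using simple_functionD[OF s, of i] by auto
    show "(\<lambda>x. \<Sum>y\<in>s i ` space M. y * indicator (?A y) x) \<in> multipliers"
      by (intro multipliers_sum multipliers_mult multipliers_const indicator_multiplier A fin)
    show "(\<Sum>y\<in>s i ` space M. y * indicator (?A y) x) = s i x" if x: "x \<in> space M" for x
    proof -
      have "(\<Sum>y\<in>s i ` space M. y * indicator (?A y) x) = (\<Sum>y\<in>s i ` space M. if s i x = y then y else 0)"
        using x by (intro sum.cong) (auto simp: indicator_def)
      then show ?thesis
        using fin x by simp
    qed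
  qed
  show ?thesis
  proof (rule poly_closure_dominated_limit)
    show "(\<lambda>x. 2 * f x) \<in> l2_space M"
      using f by (rule l2_space_cmult)
    show "s i \<in> poly_closure" for i
    proof -
      have "(\<lambda>x. s i x * poly 1 x) \<in> poly_closure"
        using simple poly_in_closure by (auto simp only: multipliers_def)
      then show ?thesis by simp
    qed
  qed (use lim bound in \<open>auto simp: abs_mult\<close>)
qed

end


section \<open>Weights satisfying Pearson's equation\<close>

lemma degree_sequence_spans:
  fixes P :: "nat \<Rightarrow> 'a::field poly"
  assumes deg: "\<And>n. degree (P n) = n" and nz: "\<And>n. P n \<noteq> 0"
    and "\<And>i. i \<ge> n \<Longrightarrow> coeff q i = 0"
  shows "\<exists>c. q = (\<Sum>i<n. smult (c i) (P i))"
  using assms(3)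
proof (induction n arbitrary: q)
  case 0
  then show ?case by (auto simp: poly_eq_iff)
next
  case (Suc n)
  define d where "d = coeff q n / coeff (P n) n"
  have "coeff (P n) n \<noteq> 0"
    using nz[of n] deg[of n] by (metis leading_coeff_neq_0)
  then have "coeff (q - smult d (P n)) i = 0" if "i \<ge> n" for i
    using that Suc.prems[of i] deg[of n] by (cases "i = n") (auto simp: d_def coeff_eq_0)
  then obtain c where "q - smult d (P n) = (\<Sum>i<n. smult (c i) (P i))"
    using Suc.IH by blast
  then have "q = (\<Sum>i<Suc n. smult ((c(n := d)) i) (P i))"
    by (simp add: diff_eq_eq)
  then show ?case by blast
qed

text \<open>
  Pearson's equation is stated in the form \<open>w' = ((\<tau> - \<sigma>') / \<sigma>) w\<close>. The signs of the leading
  coefficients of \<open>\<sigma>\<close> and \<open>\<tau>\<close> keep the degrees of the Rodrigues polynomials from dropping and the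
  eigenvalues from colliding. One exponential factor serves two purposes: it dominates every
  polynomial, both in the integrals against \<open>w\<close> and in the boundary terms \<open>\<sigma> w p\<close>.
\<close>

locale pearson_weight =
  fixes a b :: ereal and w :: "real \<Rightarrow> real" and \<sigma> \<tau> :: "real poly" and \<delta> :: real
  assumes a_less_b: "a < b"
    and degree_\<sigma>: "degree \<sigma> \<le> 2" and degree_\<tau>: "degree \<tau> \<le> 1"
    and \<sigma>2_nonpos: "coeff \<sigma> 2 \<le> 0" and \<tau>1_neg: "coeff \<tau> 1 < 0"
    and w_pos: "\<And>x. x \<in> einterval a b \<Longrightarrow> 0 < w x"
    and \<sigma>_pos: "\<And>x. x \<in> einterval a b \<Longrightarrow> 0 < poly \<sigma> x"
    and pearson: "\<And>x. x \<in> einterval a b \<Longrightarrow>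
      (w has_real_derivative poly (\<tau> - pderiv \<sigma>) x / poly \<sigma> x * w x) (at x)"
    and \<delta>_pos: "0 < \<delta>"
    and w_exp_integrable: "set_integrable lborel (einterval a b) (\<lambda>x. w x * exp (\<delta> * \<bar>x\<bar>))"
    and left_boundary: "(((\<lambda>x. poly \<sigma> x * w x * exp (\<delta> * \<bar>x\<bar>)) \<circ> real_of_ereal) \<longlongrightarrow> 0) (at_right a)"
    and right_boundary: "(((\<lambda>x. poly \<sigma> x * w x * exp (\<delta> * \<bar>x\<bar>)) \<circ> real_of_ereal) \<longlongrightarrow> 0) (at_left b)"
begin

abbreviation "I \<equiv> einterval a b"

fun rodrigues_poly :: "nat \<Rightarrow> nat \<Rightarrow> real poly" where
  "rodrigues_poly n 0 = 1"
| "rodrigues_poly n (Suc k) = \<sigma> * pderiv (rodrigues_poly n k) +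
     (smult (real n - real k - 1) (pderiv \<sigma>) + \<tau>) * rodrigues_poly n k"

abbreviation orth_poly :: "nat \<Rightarrow> real poly" where
  "orth_poly n \<equiv> rodrigues_poly n n"

lemma pderiv_pderiv_\<sigma>: "pderiv (pderiv \<sigma>) = [:2 * coeff \<sigma> 2:]"
proof (rule poly_eqI)
  fix i
  show "coeff (pderiv (pderiv \<sigma>)) i = coeff [:2 * coeff \<sigma> 2:] i"
    using degree_\<sigma> by (cases i) (auto simp: coeff_pderiv coeff_eq_0 numeral_2_eq_2)
qed

lemma pderiv_\<tau>: "pderiv \<tau> = [:coeff \<tau> 1:]"
proof (rule poly_eqI)
  fix i
  show "coeff (pderiv \<tau>) i = coeff [:coeff \<tau> 1:] i"
    using degree_\<tau> by (cases i) (auto simp: coeff_pderiv coeff_eq_0)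
qed

text \<open>
  Negative powers of \<open>\<sigma>\<close> are admitted because the differential equation involves the derivatives of
  \<open>\<sigma>\<^sup>n w\<close> of orders \<open>n + 1\<close> and \<open>n + 2\<close>.
\<close>

lemma has_derivative_weight_mult:
  assumes "x \<in> I"
  shows "((\<lambda>x. w x * poly \<sigma> x powi m * poly P x) has_real_derivative
    w x * poly \<sigma> x powi (m - 1) *
      poly (\<sigma> * pderiv P + (smult (of_int m - 1) (pderiv \<sigma>) + \<tau>) * P) x) (at x)"
proof -
  have \<sigma>: "poly \<sigma> x \<noteq> 0"
    using \<sigma>_pos[OF assms] by simp
  then have powi: "poly \<sigma> x powi m = poly \<sigma> x powi (m - 1) * poly \<sigma> x"
    using power_int_add[of "poly \<sigma> x" "m - 1" 1] by simp
  show ?thesis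
    by (rule derivative_eq_intros pearson[OF assms] poly_DERIV refl disjI2 \<sigma>)+
      (use \<sigma> in \<open>simp add: powi field_simps\<close>)
qed

lemma iterated_deriv_weight:
  assumes f: "\<And>x. x \<in> I \<Longrightarrow> f x = w x * poly \<sigma> x ^ n" and "x \<in> I"
  shows "(deriv ^^ k) f x = w x * poly \<sigma> x powi (int n - int k) * poly (rodrigues_poly n k) x"
  using \<open>x \<in> I\<close>
proof (induction k arbitrary: x)
  case 0
  then show ?case by (simp add: f)
next
  case (Suc k)
  have "\<forall>\<^sub>F y in nhds x. (deriv ^^ k) f y =
      w y * poly \<sigma> y powi (int n - int k) * poly (rodrigues_poly n k) y"
    using eventually_nhds_in_open[OF _ Suc.prems] Suc.IH by (auto elim!: eventually_mono)
  then have "deriv ((deriv ^^ k) f) x =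
      deriv (\<lambda>y. w y * poly \<sigma> y powi (int n - int k) * poly (rodrigues_poly n k) y) x"
    by (rule deriv_cong_ev) simp
  also have "\<dots> = w x * poly \<sigma> x powi (int n - int k - 1) *
      poly (\<sigma> * pderiv (rodrigues_poly n k) +
        (smult (of_int (int n - int k) - 1) (pderiv \<sigma>) + \<tau>) * rodrigues_poly n k) x"
    by (rule DERIV_imp_deriv[OF has_derivative_weight_mult[OF Suc.prems]])
  also have "int n - int k - 1 = int n - int (Suc k)"
    by simp
  also have "\<sigma> * pderiv (rodrigues_poly n k) +
      (smult (of_int (int n - int k) - 1) (pderiv \<sigma>) + \<tau>) * rodrigues_poly n k = rodrigues_poly n (Suc k)"
    by simp
  finally show ?case by simp
qed

text \<open>
  This is the Leibniz rule applied \<open>k + 1\<close> times to \<open>\<sigma> y' = ((n - 1) \<sigma>' + \<tau>) y\<close>, where \<open>y = \<sigma>\<^sup>n w\<close>; the rule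
  stops after three terms because of the degrees of \<open>\<sigma>\<close> and \<open>\<tau>\<close>. By induction: differentiating the
  recursion for \<open>R\<^sub>k\<^sub>+\<^sub>2\<close> and inserting \<open>R\<^sub>k\<^sub>+\<^sub>1' = e R\<^sub>k\<close> leaves \<open>e\<close> times the recursion for \<open>R\<^sub>k\<^sub>+\<^sub>1\<close>, plus a constant
  multiple of \<open>R\<^sub>k\<^sub>+\<^sub>1\<close>.
\<close>

lemma pderiv_rodrigues_poly:
  "pderiv (rodrigues_poly n (Suc k)) =
    smult (real (Suc k) * ((2 * real n - real k - 2) * coeff \<sigma> 2 + coeff \<tau> 1)) (rodrigues_poly n k)"
proof (induction k)
  case 0
  show ?case
    by (simp add: pderiv_add pderiv_smult pderiv_pderiv_\<sigma> pderiv_\<tau> one_pCons algebra_simps)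
next
  case (Suc k)
  define e where "e = real (Suc k) * ((2 * real n - real k - 2) * coeff \<sigma> 2 + coeff \<tau> 1)"
  define s where "s = smult (real n - real (Suc k) - 1) (pderiv \<sigma>) + \<tau>"
  let ?R = "rodrigues_poly n"
  have R': "pderiv (?R (Suc k)) = smult e (?R k)"
    unfolding e_def by (rule Suc.IH)
  have s': "pderiv s = [:(real n - real (Suc k) - 1) * (2 * coeff \<sigma> 2) + coeff \<tau> 1:]"
    by (simp add: s_def pderiv_add pderiv_smult pderiv_pderiv_\<sigma> pderiv_\<tau>)
  have s_prev: "pderiv \<sigma> + s = smult (real n - real k - 1) (pderiv \<sigma>) + \<tau>"
    using smult_diff_left[of "real n - real k - 1" 1 "pderiv \<sigma>"] by (simp add: s_def algebra_simps)
  have "?R (Suc (Suc k)) = \<sigma> * pderiv (?R (Suc k)) + s * ?R (Suc k)"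
    by (simp only: rodrigues_poly.simps(2)[of n "Suc k"] s_def)
  then have "pderiv (?R (Suc (Suc k))) =
      smult e (\<sigma> * pderiv (?R k) + (pderiv \<sigma> + s) * ?R k) + pderiv s * ?R (Suc k)"
    by (simp only: pderiv_add pderiv_mult R' pderiv_smult) (simp add: algebra_simps smult_add_right)
  also have "\<sigma> * pderiv (?R k) + (pderiv \<sigma> + s) * ?R k = ?R (Suc k)"
    by (simp add: s_prev)
  also have "smult e (?R (Suc k)) + pderiv s * ?R (Suc k) =
      smult (e + ((real n - real (Suc k) - 1) * (2 * coeff \<sigma> 2) + coeff \<tau> 1)) (?R (Suc k))"
    unfolding s' by (simp add: smult_add_left del: rodrigues_poly.simps)
  also have "e + ((real n - real (Suc k) - 1) * (2 * coeff \<sigma> 2) + coeff \<tau> 1) =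
      real (Suc (Suc k)) * ((2 * real n - real (Suc k) - 2) * coeff \<sigma> 2 + coeff \<tau> 1)"
    by (simp add: e_def algebra_simps)
  finally show ?case .
qed

lemma degree_rodrigues_poly:
  assumes "k \<le> n"
  shows "rodrigues_poly n k \<noteq> 0 \<and> degree (rodrigues_poly n k) = k"
  using assms
proof (induction k)
  case 0
  then show ?case by simp
next
  case (Suc k)
  have "2 * real n - real k - 2 \<ge> 0"
    using Suc.prems by linarith
  then have "(2 * real n - real k - 2) * coeff \<sigma> 2 \<le> 0"
    using \<sigma>2_nonpos by (rule mult_nonneg_nonpos)
  then have "(2 * real n - real k - 2) * coeff \<sigma> 2 + coeff \<tau> 1 \<noteq> 0"
    using \<tau>1_neg by linarith
  then have "pderiv (rodrigues_poly n (Suc k)) \<noteq> 0" "degree (pderiv (rodrigues_poly n (Suc k))) = k"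
    using Suc unfolding pderiv_rodrigues_poly by auto
  then show ?case
    unfolding pderiv_eq_0_iff degree_pderiv by (auto simp del: rodrigues_poly.simps)
qed

lemma degree_orth_poly: "degree (orth_poly n) = n" and orth_poly_nonzero: "orth_poly n \<noteq> 0"
  using degree_rodrigues_poly[of n n] by auto

text \<open>
  With \<open>v = w p\<^sub>n\<close> the derivatives are \<open>v' = \<sigma>\<^sup>-\<^sup>1 w R\<^sub>n\<^sub>+\<^sub>1\<close> and \<open>v'' = \<sigma>\<^sup>-\<^sup>2 w R\<^sub>n\<^sub>+\<^sub>2\<close>. In the recursion
  \<open>R\<^sub>n\<^sub>+\<^sub>2 = \<sigma> R\<^sub>n\<^sub>+\<^sub>1' + (\<tau> - 2 \<sigma>') R\<^sub>n\<^sub>+\<^sub>1\<close> the last term is cancelled by the first-order part of the operator,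
  and \<open>R\<^sub>n\<^sub>+\<^sub>1'\<close> is a multiple of \<open>R\<^sub>n\<close>.
\<close>

lemma dual_differential_equation:
  assumes v: "\<And>x. x \<in> I \<Longrightarrow> v x = C * (w x * poly (orth_poly n) x)" and "x \<in> I"
  shows "poly \<sigma> x * deriv (deriv v) x + poly (smult 2 (pderiv \<sigma>) - \<tau>) x * deriv v x =
    (real n + 1) * ((real n - 2) * coeff \<sigma> 2 + coeff \<tau> 1) * v x"
proof -
  let ?R = "rodrigues_poly n"
  have deriv_eq: "deriv g y = C * (w y * poly \<sigma> y powi (m - 1) *
      poly (\<sigma> * pderiv P + (smult (of_int m - 1) (pderiv \<sigma>) + \<tau>) * P) y)"
    if g: "\<And>y. y \<in> I \<Longrightarrow> g y = C * (w y * poly \<sigma> y powi m * poly P y)" and y: "y \<in> I" for g m P y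
  proof -
    have "\<forall>\<^sub>F z in nhds y. g z = C * (w z * poly \<sigma> z powi m * poly P z)"
      using eventually_nhds_in_open[OF _ y] g by (auto elim!: eventually_mono)
    then have "deriv g y = deriv (\<lambda>z. C * (w z * poly \<sigma> z powi m * poly P z)) y"
      by (rule deriv_cong_ev) simp
    then show ?thesis
      using DERIV_imp_deriv[OF DERIV_cmult[OF has_derivative_weight_mult[OF y]]] by simp
  qed
  have R1: "?R (Suc n) = \<sigma> * pderiv (?R n) + (smult (of_int 0 - 1) (pderiv \<sigma>) + \<tau>) * ?R n"
    by simp
  have v': "deriv v y = C * (w y * poly \<sigma> y powi (- 1) * poly (?R (Suc n)) y)" if "y \<in> I" for y
    using deriv_eq[of v 0 "?R n", OF _ that] v unfolding R1 by simp
  have R2: "?R (Suc (Suc n)) =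
      \<sigma> * pderiv (?R (Suc n)) + (smult (of_int (- 1) - 1) (pderiv \<sigma>) + \<tau>) * ?R (Suc n)"
    unfolding rodrigues_poly.simps(2)[of n "Suc n"] by simp
  have v'': "deriv (deriv v) x = C * (w x * poly \<sigma> x powi (- 2) * poly (?R (Suc (Suc n))) x)"
    using deriv_eq[of "deriv v" "- 1" "?R (Suc n)", OF v' \<open>x \<in> I\<close>] unfolding R2 by simp
  define c where "c = (real n + 1) * ((real n - 2) * coeff \<sigma> 2 + coeff \<tau> 1)"
  have "pderiv (?R (Suc n)) = smult c (?R n)"
    unfolding pderiv_rodrigues_poly by (simp add: c_def algebra_simps)
  then have R2x: "poly (?R (Suc (Suc n))) x =
      poly \<sigma> x * (c * poly (?R n) x) - poly (smult 2 (pderiv \<sigma>) - \<tau>) x * poly (?R (Suc n)) x"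
    unfolding R2 by (simp add: algebra_simps del: rodrigues_poly.simps)
  have "poly \<sigma> x \<noteq> 0"
    using \<sigma>_pos[OF \<open>x \<in> I\<close>] by simp
  then show ?thesis
    unfolding v'[OF \<open>x \<in> I\<close>] v'' v[OF \<open>x \<in> I\<close>] c_def[symmetric] R2x
    by (simp add: power_int_minus power2_eq_square field_simps del: rodrigues_poly.simps)
qed

definition eigenvalue :: "nat \<Rightarrow> real" where
  "eigenvalue n = real n * ((real n - 1) * coeff \<sigma> 2 + coeff \<tau> 1)"

text \<open>
  Differentiate \<open>R\<^sub>n\<^sub>+\<^sub>1 = \<sigma> p\<^sub>n' + (\<tau> - \<sigma>') p\<^sub>n\<close> and use that \<open>R\<^sub>n\<^sub>+\<^sub>1'\<close> is a multiple of \<open>p\<^sub>n\<close>.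
\<close>

lemma orth_poly_differential_equation:
  "\<sigma> * pderiv (pderiv (orth_poly n)) + \<tau> * pderiv (orth_poly n) =
    smult (eigenvalue n) (orth_poly n)"
proof -
  let ?p = "orth_poly n"
  have "pderiv (\<sigma> * pderiv ?p + (\<tau> - pderiv \<sigma>) * ?p) =
      smult ((real n + 1) * ((real n - 2) * coeff \<sigma> 2 + coeff \<tau> 1)) ?p"
    using pderiv_rodrigues_poly[of n n] by (simp add: algebra_simps)
  moreover have "pderiv (\<sigma> * pderiv ?p + (\<tau> - pderiv \<sigma>) * ?p) =
      \<sigma> * pderiv (pderiv ?p) + \<tau> * pderiv ?p + (pderiv \<tau> - pderiv (pderiv \<sigma>)) * ?p"
    by (simp only: pderiv_add pderiv_mult pderiv_diff) (simp add: algebra_simps)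
  moreover have "(pderiv \<tau> - pderiv (pderiv \<sigma>)) * ?p = smult (coeff \<tau> 1 - 2 * coeff \<sigma> 2) ?p"
    by (simp add: pderiv_\<tau> pderiv_pderiv_\<sigma>)
  ultimately have "\<sigma> * pderiv (pderiv ?p) + \<tau> * pderiv ?p =
      smult ((real n + 1) * ((real n - 2) * coeff \<sigma> 2 + coeff \<tau> 1)) ?p
        - smult (coeff \<tau> 1 - 2 * coeff \<sigma> 2) ?p"
    by (simp add: algebra_simps)
  also have "\<dots> = smult (eigenvalue n) ?p"
    unfolding smult_diff_left[symmetric] eigenvalue_def by (simp add: algebra_simps)
  finally show ?thesis .
qed

lemma eigenvalue_strict_antimono:
  assumes "m < n"
  shows "eigenvalue n < eigenvalue m"
proof -
  have "real m * (real m - 1) \<le> real n * (real n - 1)"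
  proof (cases "m = 0")
    case True
    then show ?thesis using assms by simp
  next
    case False
    then show ?thesis using assms by (intro mult_mono) auto
  qed
  then have "real n * (real n - 1) * coeff \<sigma> 2 \<le> real m * (real m - 1) * coeff \<sigma> 2"
    using \<sigma>2_nonpos by (rule mult_right_mono_neg)
  moreover have "real n * coeff \<tau> 1 < real m * coeff \<tau> 1"
    using assms \<tau>1_neg by simp
  ultimately show ?thesis
    by (simp add: eigenvalue_def algebra_simps)
qed

lemma continuous_on_w: "continuous_on I w"
  by (rule continuous_at_imp_continuous_on) (use pearson DERIV_isCont in blast)

abbreviation "leb_I \<equiv> restrict_space lborel I"

lemma I_measurable [measurable]: "I \<in> sets borel"
  by simp

lemma space_leb_I [simp]: "space leb_I = I"
  by simp

lemma w_measurable [measurable]: "w \<in> borel_measurable leb_I"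
proof -
  have "w \<in> borel_measurable (restrict_space borel I)"
    by (rule borel_measurable_continuous_on_restrict[OF continuous_on_w])
  then show ?thesis
    by (simp add: measurable_cong_sets[OF sets_restrict_space_cong[OF sets_lborel] refl])
qed

definition weighted_measure :: "real measure" where
  "weighted_measure = density leb_I (\<lambda>x. ennreal (w x))"

sublocale exp_moment_measure weighted_measure \<delta>
proof
  show "sets weighted_measure = sets (restrict_space borel (space weighted_measure))"
    by (simp add: weighted_measure_def sets_restrict_space_cong[OF sets_lborel])
  have "(\<lambda>x. exp (\<delta> * \<bar>x\<bar>)) \<in> borel_measurable leb_I"
    by (rule measurable_restrict_space1) measurable
  then show "integrable weighted_measure (\<lambda>x. exp (\<delta> * \<bar>x\<bar>))"
    unfolding weighted_measure_def using w_pos w_exp_integrable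
    by (subst integrable_real_density)
      (auto intro!: AE_I2 less_imp_le simp: integrable_restrict_space set_integrable_def)
qed (rule \<delta>_pos)

lemma poly_measurable_leb_I [measurable]: "poly p \<in> borel_measurable leb_I"
  using measurable_poly_M[of p] by (simp add: weighted_measure_def)

lemma poly_integrable: "set_integrable lborel I (\<lambda>x. w x * poly p x)"
proof -
  obtain C where C: "\<And>x. \<bar>poly p x\<bar> \<le> C * exp (\<delta> * \<bar>x\<bar>)"
    using abs_poly_le_exp[OF \<delta>_pos, of p] by auto
  have "integrable leb_I (\<lambda>x. C * (w x * exp (\<delta> * \<bar>x\<bar>)))"
    using w_exp_integrable by (simp add: integrable_restrict_space set_integrable_def)
  then have "integrable leb_I (\<lambda>x. w x * poly p x)"
  proof (rule Bochner_Integration.integrable_bound)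
    show "AE x in leb_I. norm (w x * poly p x) \<le> norm (C * (w x * exp (\<delta> * \<bar>x\<bar>)))"
    proof (rule AE_I2)
      fix x assume "x \<in> space leb_I"
      then have "w x > 0" using w_pos by simp
      then have "norm (w x * poly p x) \<le> w x * (C * exp (\<delta> * \<bar>x\<bar>))"
        using C[of x] by (simp add: abs_mult)
      also have "\<dots> \<le> norm (C * (w x * exp (\<delta> * \<bar>x\<bar>)))"
        by (simp add: mult.left_commute)
      finally show "norm (w x * poly p x) \<le> norm (C * (w x * exp (\<delta> * \<bar>x\<bar>)))" .
    qed
  qed measurable
  then show ?thesis
    by (simp add: integrable_restrict_space set_integrable_def)
qed

lemma poly_boundary:
  assumes "(((\<lambda>x. poly \<sigma> x * w x * exp (\<delta> * \<bar>x\<bar>)) \<circ> real_of_ereal) \<longlongrightarrow> 0) F"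
  shows "(((\<lambda>x. poly \<sigma> x * w x * poly p x) \<circ> real_of_ereal) \<longlongrightarrow> 0) F"
proof -
  obtain C where "C \<ge> 0" and C: "\<And>x. \<bar>poly p x\<bar> \<le> C * exp (\<delta> * \<bar>x\<bar>)"
    using abs_poly_le_exp[OF \<delta>_pos, of p] by auto
  show ?thesis
  proof (rule tendsto_0_le[OF assms, where K = C])
    show "\<forall>\<^sub>F x in F. norm (((\<lambda>x. poly \<sigma> x * w x * poly p x) \<circ> real_of_ereal) x)
        \<le> norm (((\<lambda>x. poly \<sigma> x * w x * exp (\<delta> * \<bar>x\<bar>)) \<circ> real_of_ereal) x) * C"
    proof (intro always_eventually allI)
      fix x :: ereal
      let ?x = "real_of_ereal x"
      have "\<bar>poly \<sigma> ?x * w ?x\<bar> * \<bar>poly p ?x\<bar> \<le> \<bar>poly \<sigma> ?x * w ?x\<bar> * (C * exp (\<delta> * \<bar>?x\<bar>))"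
        by (intro mult_left_mono C) simp
      then show "norm (((\<lambda>x. poly \<sigma> x * w x * poly p x) \<circ> real_of_ereal) x)
        \<le> norm (((\<lambda>x. poly \<sigma> x * w x * exp (\<delta> * \<bar>x\<bar>)) \<circ> real_of_ereal) x) * C"
        by (simp add: abs_mult algebra_simps)
    qed
  qed
qed

text \<open>
  The Sturm-Liouville argument: since \<open>(\<sigma> w)' = \<tau> w\<close>, the function \<open>\<sigma> w W\<close> with the Wronskian \<open>W\<close> of the
  two polynomials is a primitive of \<open>w (\<sigma> W' + \<tau> W)\<close>, which by the differential equations is the
  integrand times the difference of the eigenvalues.
\<close>

lemma orth_poly_orthogonal:
  assumes "i \<noteq> j"
  shows "(LBINT x:I. w x * poly (orth_poly i * orth_poly j) x) = 0"
proof -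
  let ?p = "orth_poly i" and ?q = "orth_poly j"
  define W where "W = ?q * pderiv ?p - ?p * pderiv ?q"
  define d where "d = eigenvalue i - eigenvalue j"
  have W: "\<sigma> * pderiv W + \<tau> * W = smult d (?p * ?q)"
  proof -
    have "\<sigma> * pderiv W + \<tau> * W = ?q * (\<sigma> * pderiv (pderiv ?p) + \<tau> * pderiv ?p)
        - ?p * (\<sigma> * pderiv (pderiv ?q) + \<tau> * pderiv ?q)"
      unfolding W_def by (simp only: pderiv_diff pderiv_mult) (simp add: algebra_simps)
    then show ?thesis
      unfolding orth_poly_differential_equation d_def by (simp add: smult_diff_left mult.commute)
  qed
  have "(LBINT x=a..b. d * (w x * poly (?p * ?q) x)) = 0 - 0"
  proof (rule interval_integral_FTC_integrable[OF a_less_b])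
    let ?F = "\<lambda>x. poly \<sigma> x * w x * poly W x"
    show "(?F has_vector_derivative d * (w x * poly (?p * ?q) x)) (at x)"
      if "a < ereal x" "ereal x < b" for x
    proof -
      have "x \<in> I"
        using that by (simp add: einterval_def)
      have "((\<lambda>x. w x * poly \<sigma> x powi 1 * poly W x) has_real_derivative
          w x * poly (\<sigma> * pderiv W + \<tau> * W) x) (at x)"
        using has_derivative_weight_mult[OF \<open>x \<in> I\<close>, of 1 W] by simp
      then show ?thesis
        unfolding W has_real_derivative_iff_has_vector_derivative[symmetric]
        by (simp add: mult_ac)
    qed
    show "isCont (\<lambda>x. d * (w x * poly (?p * ?q) x)) x" if "a < ereal x" "ereal x < b" for x
      using that DERIV_isCont[OF pearson[of x]] by (intro continuous_intros) (auto simp: einterval_def)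
    show "set_integrable lborel I (\<lambda>x. d * (w x * poly (?p * ?q) x))"
      using poly_integrable[of "?p * ?q"] by simp
    show "((?F \<circ> real_of_ereal) \<longlongrightarrow> 0) (at_right a)"
      by (rule poly_boundary[OF left_boundary])
    show "((?F \<circ> real_of_ereal) \<longlongrightarrow> 0) (at_left b)"
      by (rule poly_boundary[OF right_boundary])
  qed
  then have "d * (LBINT x:I. w x * poly (?p * ?q) x) = 0"
    using less_imp_le[OF a_less_b] by (simp add: interval_lebesgue_integral_def)
  moreover have "d \<noteq> 0"
    using assms eigenvalue_strict_antimono[of i j] eigenvalue_strict_antimono[of j i]
    unfolding d_def by (cases i j rule: linorder_cases) auto
  ultimately show ?thesis by simp
qed

text \<open>
  Everything is transported along the map \<open>f \<mapsto> w f\<close>, which multiplies inner products by \<open>K\<close> when it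
  goes from \<open>L\<^sup>2(w dx)\<close> to \<open>L\<^sup>2((K / w) dx)\<close>.
\<close>

theorem orthogonal_basis:
  assumes K: "K > 0" and C: "\<And>n. C n \<noteq> 0"
    and e: "\<And>n x. x \<in> I \<Longrightarrow> e n x = C n * (w x * poly (orth_poly n) x)"
  shows "l2_orthogonal_basis (density leb_I (\<lambda>x. ennreal (K / w x))) e"
proof -
  define \<nu> where "\<nu> = density leb_I (\<lambda>x. ennreal (K / w x))"
  have Kw: "AE x in leb_I. 0 \<le> K / w x" and w0: "AE x in leb_I. 0 \<le> w x"
    using K w_pos by (auto intro!: AE_I2 less_imp_le)
  have meas_\<nu>: "f \<in> borel_measurable \<nu> \<longleftrightarrow> f \<in> borel_measurable leb_I"
    and meas_w: "f \<in> borel_measurable weighted_measure \<longleftrightarrow> f \<in> borel_measurable leb_I"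
    for f :: "real \<Rightarrow> real"
    by (simp_all add: \<nu>_def weighted_measure_def)
  have transfer: "integrable \<nu> (\<lambda>x. w x * f x * (w x * g x)) \<longleftrightarrow> integrable weighted_measure (\<lambda>x. f x * g x)"
    "(\<integral>x. w x * f x * (w x * g x) \<partial>\<nu>) = K * (\<integral>x. f x * g x \<partial>weighted_measure)"
    if [measurable]: "f \<in> borel_measurable leb_I" "g \<in> borel_measurable leb_I" for f g
  proof -
    have eq: "K / w x * (w x * f x * (w x * g x)) = K * (w x * (f x * g x))" if "x \<in> I" for x
      using w_pos[OF that] by simp
    have "integrable \<nu> (\<lambda>x. w x * f x * (w x * g x)) \<longleftrightarrow>
        integrable leb_I (\<lambda>x. K / w x * (w x * f x * (w x * g x)))"
      unfolding \<nu>_def by (rule integrable_real_density[OF _ Kw]) measurable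
    also have "\<dots> \<longleftrightarrow> integrable leb_I (\<lambda>x. K * (w x * (f x * g x)))"
      by (rule Bochner_Integration.integrable_cong) (use eq in auto)
    also have "\<dots> \<longleftrightarrow> integrable leb_I (\<lambda>x. w x * (f x * g x))"
      using K by simp
    also have "\<dots> \<longleftrightarrow> integrable weighted_measure (\<lambda>x. f x * g x)"
      unfolding weighted_measure_def by (rule integrable_real_density[OF _ w0, symmetric]) measurable
    finally show "integrable \<nu> (\<lambda>x. w x * f x * (w x * g x)) \<longleftrightarrow>
        integrable weighted_measure (\<lambda>x. f x * g x)" .
    have "(\<integral>x. w x * f x * (w x * g x) \<partial>\<nu>) = (\<integral>x. K / w x * (w x * f x * (w x * g x)) \<partial>leb_I)"
      unfolding \<nu>_def by (rule integral_real_density[OF _ Kw]) measurable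
    also have "\<dots> = (\<integral>x. K * (w x * (f x * g x)) \<partial>leb_I)"
      by (rule Bochner_Integration.integral_cong) (use eq in auto)
    also have "\<dots> = K * (\<integral>x. w x * (f x * g x) \<partial>leb_I)"
      by simp
    also have "(\<integral>x. w x * (f x * g x) \<partial>leb_I) = (\<integral>x. f x * g x \<partial>weighted_measure)"
      unfolding weighted_measure_def by (rule integral_real_density[OF _ w0, symmetric]) measurable
    finally show "(\<integral>x. w x * f x * (w x * g x) \<partial>\<nu>) = K * (\<integral>x. f x * g x \<partial>weighted_measure)" .
  qed
  have space_\<nu>: "space \<nu> = I"
    by (simp add: \<nu>_def)
  have e_meas [measurable]: "e n \<in> borel_measurable leb_I" for n
  proof -
    have "(\<lambda>x. C n * (w x * poly (orth_poly n) x)) \<in> borel_measurable leb_I"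
      by measurable
    then show ?thesis
      by (subst measurable_cong[OF e]) auto
  qed
  have e_w: "e n x = w x * poly (smult (C n) (orth_poly n)) x" if "x \<in> I" for n x
    using e[OF that] by simp
  have e_l2: "e n \<in> l2_space \<nu>" for n
  proof -
    have "integrable \<nu> (\<lambda>x. (e n x)\<^sup>2) \<longleftrightarrow>
        integrable \<nu> (\<lambda>x. w x * poly (smult (C n) (orth_poly n)) x * (w x * poly (smult (C n) (orth_poly n)) x))"
      by (rule Bochner_Integration.integrable_cong) (auto simp only: space_\<nu> e_w power2_eq_square)
    also have "\<dots>"
      using poly_l2[of "smult (C n) (orth_poly n)"] unfolding transfer(1)[OF poly_measurable_leb_I poly_measurable_leb_I]
      by (simp only: l2_space_def power2_eq_square mem_Collect_eq)
    finally show ?thesis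
      by (simp add: l2_space_def meas_\<nu>)
  qed
  have e_orth: "l2_inner \<nu> (e i) (e j) = 0" if "i \<noteq> j" for i j
  proof -
    have "l2_inner \<nu> (e i) (e j) =
        (\<integral>x. w x * poly (smult (C i) (orth_poly i)) x * (w x * poly (smult (C j) (orth_poly j)) x) \<partial>\<nu>)"
      unfolding l2_inner_def
      by (rule Bochner_Integration.integral_cong) (auto simp only: space_\<nu> e_w)
    also have "\<dots> = K * (\<integral>x. poly (smult (C i) (orth_poly i)) x * poly (smult (C j) (orth_poly j)) x \<partial>weighted_measure)"
      by (rule transfer(2)) measurable
    also have "(\<integral>x. poly (smult (C i) (orth_poly i)) x * poly (smult (C j) (orth_poly j)) x \<partial>weighted_measure) =
        (\<integral>x. w x * (poly (smult (C i) (orth_poly i)) x * poly (smult (C j) (orth_poly j)) x) \<partial>leb_I)"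
      unfolding weighted_measure_def by (rule integral_real_density[OF _ w0]) measurable
    also have "\<dots> = (\<integral>x. C i * C j * (w x * poly (orth_poly i * orth_poly j) x) \<partial>leb_I)"
      by (rule Bochner_Integration.integral_cong) auto
    also have "\<dots> = C i * C j * (\<integral>x. w x * poly (orth_poly i * orth_poly j) x \<partial>leb_I)"
      by (rule integral_mult_right_zero)
    also have "(\<integral>x. w x * poly (orth_poly i * orth_poly j) x \<partial>leb_I) = 0"
      using orth_poly_orthogonal[OF that]
      by (subst integral_restrict_space) (auto simp: set_lebesgue_integral_def)
    finally show ?thesis by simp
  qed
  have e_nonzero: "\<not> (AE x in \<nu>. e n x = 0)" for n
  proof
    assume "AE x in \<nu>. e n x = 0"
    then have "AE x in leb_I. 0 < ennreal (K / w x) \<longrightarrow> e n x = 0"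
      unfolding \<nu>_def by (subst (asm) AE_density) auto
    then have "AE x in lborel. x \<in> I \<longrightarrow> 0 < ennreal (K / w x) \<longrightarrow> e n x = 0"
      by (subst (asm) AE_restrict_space_iff) auto
    then have "AE x in lborel. x \<in> I \<longrightarrow> poly (orth_poly n) x = 0"
    proof eventually_elim
      case (elim x)
      show ?case
      proof
        assume x: "x \<in> I"
        then have "e n x = 0"
          using elim K w_pos[OF x] by simp
        then show "poly (orth_poly n) x = 0"
          using C[of n] w_pos[OF x] e[OF x] by simp
      qed
    qed
    moreover have "AE x in lborel. poly (orth_poly n) x \<noteq> 0"
      using poly_roots_finite[OF orth_poly_nonzero, of n]
      by (intro AE_I'[of "{x. poly (orth_poly n) x = 0}"] finite_imp_null_set_lborel) auto
    ultimately have "AE x in lborel. x \<notin> I"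
      by eventually_elim auto
    then have "emeasure lborel I = 0"
      by (subst (asm) AE_iff_measurable[of I]) auto
    then have "I \<in> null_sets lborel"
      by (simp add: null_sets_def)
    then have "negligible I"
      by (simp add: negligible_iff_null_sets null_sets_completionI)
    moreover have "I \<noteq> {}"
    proof -
      obtain x where "a < ereal x" "ereal x < b"
        using ereal_dense2[OF a_less_b] by auto
      then show ?thesis by (auto simp: einterval_def)
    qed
    ultimately show False
      using open_not_negligible[OF open_einterval] by blast
  qed
  have e_dense: "\<exists>J c. finite J \<and> l2_norm \<nu> (\<lambda>x. f x - (\<Sum>i\<in>J. c i * e i x)) < \<epsilon>"
    if f: "f \<in> l2_space \<nu>" and \<epsilon>: "\<epsilon> > 0" for f \<epsilon>
  proof -
    have [measurable]: "f \<in> borel_measurable leb_I"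
      using f by (simp add: l2_space_def meas_\<nu>)
    define g where "g x = f x / w x" for x
    have g_meas [measurable]: "g \<in> borel_measurable leb_I"
      unfolding g_def[abs_def] by measurable
    have f_eq: "f x = w x * g x" if "x \<in> I" for x
      using w_pos[OF that] by (simp add: g_def)
    have "integrable \<nu> (\<lambda>x. (f x)\<^sup>2) \<longleftrightarrow> integrable \<nu> (\<lambda>x. w x * g x * (w x * g x))"
      by (rule Bochner_Integration.integrable_cong) (auto simp only: space_\<nu> f_eq power2_eq_square)
    then have "g \<in> l2_space weighted_measure"
      using f transfer(1)[OF g_meas g_meas] by (simp add: l2_space_def meas_w power2_eq_square)
    then have "g \<in> poly_closure"
      by (rule polynomials_dense)
    moreover have "\<epsilon>\<^sup>2 / K > 0"
      using \<epsilon> K by simp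
    ultimately obtain p where p: "(\<integral>x. (g x - poly p x)\<^sup>2 \<partial>weighted_measure) < \<epsilon>\<^sup>2 / K"
      unfolding poly_closure_def by blast
    obtain c where c: "p = (\<Sum>i<Suc (degree p). smult (c i) (orth_poly i))"
      using degree_sequence_spans[of orth_poly "Suc (degree p)" p] degree_orth_poly orth_poly_nonzero
      by (auto simp: coeff_eq_0)
    define J where "J = {..<Suc (degree p)}"
    have sum_eq: "(\<Sum>i\<in>J. c i / C i * e i x) = w x * poly p x" if "x \<in> I" for x
    proof -
      have "(\<Sum>i\<in>J. c i / C i * e i x) = (\<Sum>i\<in>J. w x * (c i * poly (orth_poly i) x))"
        using C e[OF that] by (intro sum.cong) auto
      also have "\<dots> = w x * poly p x"
        by (subst c) (simp add: J_def poly_sum sum_distrib_left distrib_left)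
      finally show ?thesis .
    qed
    have error_eq: "f x - (\<Sum>i\<in>J. c i / C i * e i x) = w x * (g x - poly p x)" if "x \<in> I" for x
      by (simp only: f_eq[OF that] sum_eq[OF that] right_diff_distrib)
    have "l2_inner \<nu> (\<lambda>x. f x - (\<Sum>i\<in>J. c i / C i * e i x)) (\<lambda>x. f x - (\<Sum>i\<in>J. c i / C i * e i x)) =
        (\<integral>x. w x * (g x - poly p x) * (w x * (g x - poly p x)) \<partial>\<nu>)"
      unfolding l2_inner_def
      by (rule Bochner_Integration.integral_cong)
        (simp_all only: space_\<nu> error_eq)
    also have "\<dots> = K * (\<integral>x. (g x - poly p x) * (g x - poly p x) \<partial>weighted_measure)"
      by (rule transfer(2)) measurable
    also have "\<dots> < \<epsilon>\<^sup>2"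
      using p K by (simp add: power2_eq_square field_simps)
    finally have "l2_norm \<nu> (\<lambda>x. f x - (\<Sum>i\<in>J. c i / C i * e i x)) < \<epsilon>"
      unfolding l2_norm_def using \<epsilon> by (intro real_less_lsqrt) auto
    then show ?thesis
      by (intro exI[of _ J] exI[of _ "\<lambda>i. c i / C i"]) (simp add: J_def)
  qed
  show ?thesis
    unfolding \<nu>_def[symmetric] l2_orthogonal_basis_def l2_orthogonal_def
    using e_l2 e_orth e_nonzero e_dense by auto
qed

end

section \<open>The Gaussian, gamma and beta weights\<close>

lemma set_integrable_continuous_bound:
  fixes f g :: "real \<Rightarrow> real"
  assumes "set_integrable lborel A g" "A \<in> sets borel" "continuous_on A f"
    and "\<And>x. x \<in> A \<Longrightarrow> \<bar>f x\<bar> \<le> C * g x"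
  shows "set_integrable lborel A f"
proof (rule set_integrable_bound)
  show "set_integrable lborel A (\<lambda>x. C * g x)"
    using assms(1) by simp
  show "set_borel_measurable lborel A f"
    using borel_measurable_continuous_on_indicator[OF assms(2,3)]
    by (simp add: set_borel_measurable_def)
  show "AE x in lborel. x \<in> A \<longrightarrow> norm (f x) \<le> norm (C * g x)"
    using assms(4) by (intro AE_I2 impI) (metis abs_ge_self order_trans real_norm_def)
qed

lemma pearson_gaussian: "pearson_weight (- \<infinity>) \<infinity> (\<lambda>x. exp (- x\<^sup>2)) 1 [:0, - 2:] 1"
proof
  show "((\<lambda>x. exp (- x\<^sup>2)) has_real_derivative
      poly ([:0, - 2:] - pderiv 1) x / poly 1 x * exp (- x\<^sup>2)) (at x)" for x :: real
    by (auto intro!: derivative_eq_intros)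
  show "set_integrable lborel (einterval (- \<infinity>) \<infinity>) (\<lambda>x. exp (- x\<^sup>2) * exp (1 * \<bar>x\<bar>))"
  proof (rule set_integrable_continuous_bound)
    show "set_integrable lborel (einterval (- \<infinity>) \<infinity>) std_normal_density"
      by (simp add: set_integrable_def)
    show "continuous_on (einterval (- \<infinity>) \<infinity>) (\<lambda>x. exp (- x\<^sup>2) * exp (1 * \<bar>x\<bar>))"
      by (intro continuous_intros)
    show "\<bar>exp (- x\<^sup>2) * exp (1 * \<bar>x\<bar>)\<bar> \<le> exp (1 / 2) * sqrt (2 * pi) * std_normal_density x" for x
    proof -
      \<comment> \<open>This is \<open>(\<bar>x\<bar> - 1)\<^sup>2 \<ge> 0\<close> rearranged; it absorbs the exponential factor into half of the Gaussian.\<close>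
      have "- x\<^sup>2 + \<bar>x\<bar> \<le> 1 / 2 + - x\<^sup>2 / 2"
        using zero_le_power2[of "\<bar>x\<bar> - 1"] by (simp add: power2_diff)
      then show ?thesis
        by (simp add: std_normal_density_def flip: exp_add)
    qed
  qed simp
  show "(((\<lambda>x. poly 1 x * exp (- x\<^sup>2) * exp (1 * \<bar>x\<bar>)) \<circ> real_of_ereal) \<longlongrightarrow> 0) (at_right (- \<infinity>))"
    unfolding ereal_tendsto_simps by simp real_asymp
  show "(((\<lambda>x. poly 1 x * exp (- x\<^sup>2) * exp (1 * \<bar>x\<bar>)) \<circ> real_of_ereal) \<longlongrightarrow> 0) (at_left \<infinity>)"
    unfolding ereal_tendsto_simps by simp real_asymp
qed auto

lemma pearson_gamma:
  assumes "\<alpha> > -1"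
  shows "pearson_weight 0 \<infinity> (\<lambda>x. exp (- x) * x powr \<alpha>) [:0, 1:] [:\<alpha> + 1, - 1:] (1 / 2)"
proof
  let ?w = "\<lambda>x. exp (- x) * x powr \<alpha>"
  have I: "einterval 0 \<infinity> = {0::real<..}"
    by (simp add: zero_ereal_def)
  show "(?w has_real_derivative
      poly ([:\<alpha> + 1, - 1:] - pderiv [:0, 1:]) x / poly [:0, 1:] x * ?w x) (at x)"
    if "x \<in> einterval 0 \<infinity>" for x :: real
    using that unfolding I
    by (auto intro!: derivative_eq_intros simp: pderiv_pCons powr_diff field_simps)
  show "set_integrable lborel (einterval 0 \<infinity>) (\<lambda>x. ?w x * exp (1 / 2 * \<bar>x\<bar>))"
  proof -
    \<comment> \<open>The factor \<open>exp (x / 2)\<close> leaves the integrand of Euler's integral for \<open>\<Gamma>(\<alpha> + 1)\<close> with \<open>exp (- x / 2)\<close>.\<close>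
    have "set_integrable lebesgue {0<..} (\<lambda>t. norm (complex_of_real t powr (complex_of_real (\<alpha> + 1) - 1) / of_real (exp (1 / 2 * t))))"
      using assms by (intro set_integrable_norm absolutely_integrable_Gamma_integral) auto
    also have "?this \<longleftrightarrow> set_integrable lebesgue {0<..} (\<lambda>x. ?w x * exp (1 / 2 * \<bar>x\<bar>))"
      by (intro set_integrable_cong) (auto simp: norm_divide norm_powr_real_powr field_simps simp flip: exp_add)
    finally show ?thesis
      unfolding I set_integrable_def
      by (subst (asm) integrable_completion)
        (auto intro!: borel_measurable_continuous_on_indicator continuous_intros)
  qed
  show "(((\<lambda>x. poly [:0, 1:] x * ?w x * exp (1 / 2 * \<bar>x\<bar>)) \<circ> real_of_ereal) \<longlongrightarrow> 0) (at_right 0)"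
  proof -
    have "((\<lambda>x. x powr (\<alpha> + 1) * (exp (- x) * exp (1 / 2 * \<bar>x\<bar>))) \<longlongrightarrow>
        0 powr (\<alpha> + 1) * (exp (- 0) * exp (1 / 2 * \<bar>0\<bar>))) (at_right 0)"
      using assms by (intro tendsto_intros) (auto simp: eventually_at_filter)
    moreover have "\<forall>\<^sub>F x in at_right 0. x powr (\<alpha> + 1) * (exp (- x) * exp (1 / 2 * \<bar>x\<bar>)) =
        poly [:0, 1:] x * ?w x * exp (1 / 2 * \<bar>x\<bar>)"
      by (auto simp: eventually_at_filter powr_add)
    ultimately have "((\<lambda>x. poly [:0, 1:] x * ?w x * exp (1 / 2 * \<bar>x\<bar>)) \<longlongrightarrow>
        0 powr (\<alpha> + 1) * (exp (- 0) * exp (1 / 2 * \<bar>0\<bar>))) (at_right 0)"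
      by (rule Lim_transform_eventually)
    then show ?thesis
      unfolding zero_ereal_def ereal_tendsto_simps by simp
  qed
  show "(((\<lambda>x. poly [:0, 1:] x * ?w x * exp (1 / 2 * \<bar>x\<bar>)) \<circ> real_of_ereal) \<longlongrightarrow> 0) (at_left \<infinity>)"
    unfolding ereal_tendsto_simps by simp real_asymp
qed (auto simp: zero_ereal_def numeral_2_eq_2)

lemma jacobi_weight_integrable:
  assumes "\<alpha> > -1" "\<beta> > -1"
  shows "set_integrable lborel {-1<..<1} (\<lambda>x::real. (1 - x) powr \<alpha> * (1 + x) powr \<beta>)"
proof -
  have "set_integrable lborel {0..1} (\<lambda>t. t powr (\<beta> + 1 - 1) * (1 - t) powr (\<alpha> + 1 - 1))"
    using assms by (intro integrable_Beta) auto
  \<comment> \<open>Substitute \<open>t = (1 + x) / 2\<close> in the beta integral.\<close>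
  then have "integrable lborel (\<lambda>x. indicator {0..1} (1/2 + 1/2 * x) *\<^sub>R
      ((1/2 + 1/2 * x) powr \<beta> * (1 - (1/2 + 1/2 * x)) powr \<alpha>))"
    using lborel_integrable_real_affine[of "\<lambda>t. indicator {0..1} t *\<^sub>R (t powr \<beta> * (1 - t) powr \<alpha>)" "1/2" "1/2"]
    by (simp add: set_integrable_def)
  also have "(\<lambda>x. indicator {0..1} (1/2 + 1/2 * x) *\<^sub>R
      ((1/2 + 1/2 * x) powr \<beta> * (1 - (1/2 + 1/2 * x)) powr \<alpha>)) =
      (\<lambda>x. indicator {-1..1} x *\<^sub>R (((1 + x) / 2) powr \<beta> * ((1 - x) / 2) powr \<alpha>))"
    by (auto simp: fun_eq_iff indicator_def field_simps)
  finally have "set_integrable lborel {-1..1} (\<lambda>x. ((1 + x) / 2) powr \<beta> * ((1 - x) / 2) powr \<alpha>)"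
    by (simp add: set_integrable_def)
  then have "set_integrable lborel {-1<..<1} (\<lambda>x. ((1 + x) / 2) powr \<beta> * ((1 - x) / 2) powr \<alpha>)"
    by (rule set_integrable_subset) auto
  then show ?thesis
  proof (rule set_integrable_continuous_bound)
    show "continuous_on {-1<..<1} (\<lambda>x::real. (1 - x) powr \<alpha> * (1 + x) powr \<beta>)"
      by (intro continuous_intros) auto
    show "\<bar>(1 - x) powr \<alpha> * (1 + x) powr \<beta>\<bar> \<le>
        2 powr (\<alpha> + \<beta>) * (((1 + x) / 2) powr \<beta> * ((1 - x) / 2) powr \<alpha>)" if "x \<in> {-1<..<1}" for x
      using that by (simp add: powr_divide powr_add)
  qed simp
qed

lemma pearson_beta:
  assumes "\<alpha> > -1" "\<beta> > -1"
  shows "pearson_weight (-1) 1 (\<lambda>x. (1 - x) powr \<alpha> * (1 + x) powr \<beta>)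
    [:1, 0, - 1:] [:\<beta> - \<alpha>, - (\<alpha> + \<beta> + 2):] 1"
proof
  let ?w = "\<lambda>x. (1 - x) powr \<alpha> * (1 + x) powr \<beta>"
  let ?F = "\<lambda>x. poly [:1, 0, - 1:] x * ?w x * exp (1 * \<bar>x\<bar>)"
  have I: "einterval (-1) 1 = {-1<..<1::real}"
    by (simp add: one_ereal_def)
  show "0 < poly [:1, 0, - 1:] x" if "x \<in> einterval (-1) 1" for x :: real
  proof -
    have "0 < (1 - x) * (1 + x)"
      using that unfolding I by (intro mult_pos_pos) auto
    then show ?thesis by (simp add: algebra_simps)
  qed
  show "(?w has_real_derivative
      poly ([:\<beta> - \<alpha>, - (\<alpha> + \<beta> + 2):] - pderiv [:1, 0, - 1:]) x / poly [:1, 0, - 1:] x * ?w x) (at x)"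
    if "x \<in> einterval (-1) 1" for x :: real
  proof -
    have x: "1 - x > 0" "1 + x > 0"
      using that unfolding I by auto
    have "(?w has_real_derivative (\<beta> / (1 + x) - \<alpha> / (1 - x)) * ?w x) (at x)"
      using x by (auto intro!: derivative_eq_intros simp: powr_diff field_simps)
    also have "\<beta> / (1 + x) - \<alpha> / (1 - x) =
        poly ([:\<beta> - \<alpha>, - (\<alpha> + \<beta> + 2):] - pderiv [:1, 0, - 1:]) x / ((1 + x) * (1 - x))"
      using x by (simp add: pderiv_pCons field_simps)
    also have "(1 + x) * (1 - x) = poly [:1, 0, - 1:] x"
      by (simp add: algebra_simps)
    finally show ?thesis .
  qed
  show "set_integrable lborel (einterval (-1) 1) (\<lambda>x. ?w x * exp (1 * \<bar>x\<bar>))"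
    unfolding I
  proof (rule set_integrable_continuous_bound[OF jacobi_weight_integrable[OF assms], where C = "exp 1"])
    show "continuous_on {-1<..<1} (\<lambda>x. ?w x * exp (1 * \<bar>x\<bar>))"
      by (intro continuous_intros) auto
    show "\<bar>?w x * exp (1 * \<bar>x\<bar>)\<bar> \<le> exp 1 * ?w x" if "x \<in> {-1<..<1}" for x
    proof -
      have "?w x * exp (1 * \<bar>x\<bar>) \<le> ?w x * exp 1"
        using that by (intro mult_left_mono) auto
      then show ?thesis by (simp add: abs_mult mult_ac)
    qed
  qed simp
  have F: "?F x = (1 - x) powr (\<alpha> + 1) * (1 + x) powr (\<beta> + 1) * exp \<bar>x\<bar>"
    if "x \<in> {-1<..<1}" for x
    using that by (simp add: powr_add algebra_simps)
  have lim: "((\<lambda>x. (1 - x) powr (\<alpha> + 1) * (1 + x) powr (\<beta> + 1) * exp \<bar>x\<bar>) \<longlongrightarrow>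
      (1 - c) powr (\<alpha> + 1) * (1 + c) powr (\<beta> + 1) * exp \<bar>c\<bar>) (at c within {-1<..<1})" for c
    using assms by (intro tendsto_intros) (auto simp: eventually_at_filter)
  have F_lim: "(?F \<longlongrightarrow> (1 - c) powr (\<alpha> + 1) * (1 + c) powr (\<beta> + 1) * exp \<bar>c\<bar>) (at c within {-1<..<1})" for c
  proof (rule Lim_transform_eventually[OF lim])
    show "\<forall>\<^sub>F x in at c within {-1<..<1}.
        (1 - x) powr (\<alpha> + 1) * (1 + x) powr (\<beta> + 1) * exp \<bar>x\<bar> = ?F x"
      unfolding eventually_at_filter by (intro always_eventually allI impI) (rule F[symmetric])
  qed
  have "at_right (-1) = at (-1::real) within {-1<..<1}"
    by (rule at_within_nhd[where S = "{-2<..<0}"]) auto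
  moreover have "at_left 1 = at (1::real) within {-1<..<1}"
    by (rule at_within_nhd[where S = "{0<..<2}"]) auto
  ultimately show "((?F \<circ> real_of_ereal) \<longlongrightarrow> 0) (at_right (-1))" "((?F \<circ> real_of_ereal) \<longlongrightarrow> 0) (at_left 1)"
    using F_lim[of "-1"] F_lim[of 1]
    by (simp_all add: one_ereal_def ereal_tendsto_simps)
qed (use assms in \<open>auto simp: one_ereal_def numeral_2_eq_2\<close>)

section \<open>Hermite, Laguerre and Jacobi functions\<close>

theorem hermite_functions:
  "(\<forall>n x. hermite_op (hermite_star n) x = - (2 * real n + 2) * hermite_star n x) \<and>
   l2_orthogonal_basis inverse_gaussian_measure hermite_star"
proof -
  interpret pearson_weight "- \<infinity>" \<infinity> "\<lambda>x. exp (- x\<^sup>2)" 1 "[:0, - 2:]" 1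
    by (rule pearson_gaussian)
  have star: "hermite_star n x = (-1) ^ n * (exp (- x\<^sup>2) * poly (orth_poly n) x)" for n x
    using iterated_deriv_weight[of "\<lambda>x. exp (- x\<^sup>2)" n x n]
    by (simp add: hermite_star_def hermite_def mult.left_commute flip: mult.assoc exp_add)
  have "hermite_op (hermite_star n) x = - (2 * real n + 2) * hermite_star n x" for n x
    using dual_differential_equation[of "hermite_star n" "(-1) ^ n" n x] star
    by (simp add: hermite_op_def algebra_simps)
  moreover have "restrict_space lborel UNIV = (lborel :: real measure)"
    by (rule measure_eqI) (auto simp: sets_restrict_space emeasure_restrict_space)
  then have "inverse_gaussian_measure = density leb_I (\<lambda>x. ennreal (sqrt pi / exp (- x\<^sup>2)))"
    by (simp add: inverse_gaussian_measure_def exp_minus divide_inverse)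
  then have "l2_orthogonal_basis inverse_gaussian_measure hermite_star"
    using orthogonal_basis[of "sqrt pi" "\<lambda>n. (-1) ^ n" hermite_star] star by simp
  ultimately show ?thesis by blast
qed

theorem laguerre_functions:
  assumes "\<alpha> > -1"
  shows "(\<forall>n. \<forall>x>0. laguerre_op \<alpha> (laguerre_star \<alpha> n) x = - (real n + 1) * laguerre_star \<alpha> n x) \<and>
    l2_orthogonal_basis (inverse_laguerre_measure \<alpha>) (laguerre_star \<alpha>)"
proof -
  interpret pearson_weight 0 \<infinity> "\<lambda>x. exp (- x) * x powr \<alpha>" "[:0, 1:]" "[:\<alpha> + 1, - 1:]" "1 / 2"
    using assms by (rule pearson_gamma)
  have I: "I = {0<..}"
    by (simp add: zero_ereal_def)
  have star: "laguerre_star \<alpha> n x = 1 / fact n * (exp (- x) * x powr \<alpha> * poly (orth_poly n) x)"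
    if "x \<in> I" for n x
  proof -
    have "(deriv ^^ n) (\<lambda>y. exp (- y) * y powr (real n + \<alpha>)) x = exp (- x) * x powr \<alpha> * poly (orth_poly n) x"
      using iterated_deriv_weight[of "\<lambda>y. exp (- y) * y powr (real n + \<alpha>)" n x n] that
      by (simp add: I powr_add powr_realpow)
    moreover have "exp (- x) * x powr \<alpha> * (exp x * x powr (- \<alpha>)) = 1"
      using that by (simp add: I powr_minus exp_minus field_simps)
    ultimately have "1 / fact n * (exp (- x) * x powr \<alpha> * poly (orth_poly n) x) =
        exp (- x) * x powr \<alpha> * (exp x * x powr (- \<alpha>)) / fact n *
          (deriv ^^ n) (\<lambda>y. exp (- y) * y powr (real n + \<alpha>)) x"
      by simp
    then show ?thesis
      unfolding laguerre_star_def laguerre_def by (simp only: mult_ac times_divide_eq_right times_divide_eq_left)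
  qed
  have "laguerre_op \<alpha> (laguerre_star \<alpha> n) x = - (real n + 1) * laguerre_star \<alpha> n x" if "x \<in> I" for n x
    using dual_differential_equation[of "laguerre_star \<alpha> n" "1 / fact n" n x, OF star] that
    by (simp add: laguerre_op_def pderiv_pCons numeral_2_eq_2 algebra_simps)
  moreover have "exp x * x powr (- \<alpha>) = 1 / (exp (- x) * x powr \<alpha>)" for x
    by (simp add: exp_minus powr_minus field_simps)
  then have "inverse_laguerre_measure \<alpha> = density leb_I (\<lambda>x. ennreal (1 / (exp (- x) * x powr \<alpha>)))"
    unfolding inverse_laguerre_measure_def I by simp
  then have "l2_orthogonal_basis (inverse_laguerre_measure \<alpha>) (laguerre_star \<alpha>)"
    using orthogonal_basis[of 1 "\<lambda>n. 1 / fact n" "laguerre_star \<alpha>"] star by simp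
  ultimately show ?thesis
    unfolding I by blast
qed

theorem jacobi_functions:
  assumes "\<alpha> > -1" "\<beta> > -1"
  shows "(\<forall>n. \<forall>x\<in>{-1<..<1}. jacobi_op \<alpha> \<beta> (jacobi_star \<alpha> \<beta> n) x =
      (- real n * (real n + \<alpha> + \<beta> + 1) - (\<alpha> + \<beta>)) * jacobi_star \<alpha> \<beta> n x) \<and>
    l2_orthogonal_basis (inverse_jacobi_measure \<alpha> \<beta>) (jacobi_star \<alpha> \<beta>)"
proof -
  interpret pearson_weight "-1" 1 "\<lambda>x. (1 - x) powr \<alpha> * (1 + x) powr \<beta>"
    "[:1, 0, - 1:]" "[:\<beta> - \<alpha>, - (\<alpha> + \<beta> + 2):]" 1
    using assms by (rule pearson_beta)
  have I: "I = {-1<..<1}"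
    by (simp add: one_ereal_def)
  define C where "C n = (-1) ^ n / (2 ^ n * fact n :: real)" for n
  have star: "jacobi_star \<alpha> \<beta> n x = C n * ((1 - x) powr \<alpha> * (1 + x) powr \<beta> * poly (orth_poly n) x)"
    if "x \<in> I" for n x
  proof -
    have weight: "(1 - y) powr (\<alpha> + real n) * (1 + y) powr (\<beta> + real n) =
        (1 - y) powr \<alpha> * (1 + y) powr \<beta> * poly [:1, 0, - 1:] y ^ n" if "y \<in> I" for y
    proof -
      have "poly [:1, 0, - 1:] y = (1 - y) * (1 + y)"
        by (simp add: algebra_simps)
      then show ?thesis
        using that by (simp add: I powr_add powr_realpow power_mult_distrib)
    qed
    have "(deriv ^^ n) (\<lambda>y. (1 - y) powr (\<alpha> + real n) * (1 + y) powr (\<beta> + real n)) x =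
        (1 - x) powr \<alpha> * (1 + x) powr \<beta> * poly (orth_poly n) x"
      using iterated_deriv_weight[OF weight that, where k = n] by simp
    moreover have "(1 - x) powr \<alpha> * (1 - x) powr (- \<alpha>) = 1" "(1 + x) powr \<beta> * (1 + x) powr (- \<beta>) = 1"
      using that by (simp_all add: I powr_minus)
    ultimately have "C n * ((1 - x) powr \<alpha> * (1 + x) powr \<beta> * poly (orth_poly n) x) =
        C n * ((1 - x) powr \<alpha> * (1 - x) powr (- \<alpha>)) * ((1 + x) powr \<beta> * (1 + x) powr (- \<beta>)) *
          (deriv ^^ n) (\<lambda>y. (1 - y) powr (\<alpha> + real n) * (1 + y) powr (\<beta> + real n)) x"
      by simp
    then show ?thesis
      unfolding jacobi_star_def jacobi_def C_def by (simp only: mult_ac)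
  qed
  have "jacobi_op \<alpha> \<beta> (jacobi_star \<alpha> \<beta> n) x =
      (- real n * (real n + \<alpha> + \<beta> + 1) - (\<alpha> + \<beta>)) * jacobi_star \<alpha> \<beta> n x" if "x \<in> I" for n x
    using dual_differential_equation[of "jacobi_star \<alpha> \<beta> n" "C n" n x, OF star] that
    by (simp add: jacobi_op_def pderiv_pCons numeral_2_eq_2 algebra_simps)
  moreover have "inverse_jacobi_measure \<alpha> \<beta> =
      density leb_I (\<lambda>x. ennreal (1 / ((1 - x) powr \<alpha> * (1 + x) powr \<beta>)))"
    by (simp add: inverse_jacobi_measure_def I powr_minus divide_inverse)
  then have "l2_orthogonal_basis (inverse_jacobi_measure \<alpha> \<beta>) (jacobi_star \<alpha> \<beta>)"
    using orthogonal_basis[of 1 C "jacobi_star \<alpha> \<beta>"] star by (simp add: C_def)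
  ultimately show ?thesis
    unfolding I by blast
qed

theorem theorem1p4:
  shows
    "(l2_orthogonal inverse_gaussian_measure hermite_star \<and>
      (\<forall>n x. hermite_op (hermite_star n) x = - (2 * real n + 2) * hermite_star n x) \<and>
      l2_orthogonal_basis inverse_gaussian_measure hermite_star)
     \<and>
     (\<forall>\<alpha>>-1.
      l2_orthogonal (inverse_laguerre_measure \<alpha>) (laguerre_star \<alpha>) \<and>
      (\<forall>n. \<forall>x>0. laguerre_op \<alpha> (laguerre_star \<alpha> n) x = - (real n + 1) * laguerre_star \<alpha> n x) \<and>
      l2_orthogonal_basis (inverse_laguerre_measure \<alpha>) (laguerre_star \<alpha>))
     \<and>
     (\<forall>\<alpha>>-1. \<forall>\<beta>>-1.
      l2_orthogonal (inverse_jacobi_measure \<alpha> \<beta>) (jacobi_star \<alpha> \<beta>) \<and>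
      (\<forall>n. \<forall>x\<in>{-1<..<1}. jacobi_op \<alpha> \<beta> (jacobi_star \<alpha> \<beta> n) x =
          (- real n * (real n + \<alpha> + \<beta> + 1) - (\<alpha> + \<beta>)) * jacobi_star \<alpha> \<beta> n x) \<and>
      l2_orthogonal_basis (inverse_jacobi_measure \<alpha> \<beta>) (jacobi_star \<alpha> \<beta>))"
  using hermite_functions laguerre_functions jacobi_functions
  by (simp add: l2_orthogonal_basis_def)

end
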